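(* Let $f:\mathbb R^n\to[0,\infty)$, $n\ge2$, be an $L_p$-nested function, $\mathcal I$ the set of inner nodes (including the root) of its tree, and $\mathcal L$ the set of multi-indices of nodes on the path from the root node to the leaf corresponding to $x_n$, excluding the root and including the leaf. The uniform distribution on the $L_p$-nested unit sphere $\mathbb L_f=\{\boldsymbol x\in\mathbb R^n: f(\boldsymbol x)=1\}$ is given by the following density over its first $n-1$ coordinates $u_1,\dots,u_{n-1}$ (on the set of $(u_1,\dots,u_{n-1})$ with $f(u_1,\dots,u_{n-1},0)<1$): $$\rho(u_1,\dots,u_{n-1})=\frac{\prod_{L\in\mathcal L}G_L(\boldsymbol u_{\widehat L})}{2^{n-1}}\prod_{I\in\mathcal I}p_I^{\ell_I-1}\prod_{k=1}^{\ell_I-1}B\left[\frac{\sum_{i=1}^k n_{I,i}}{p_I},\frac{n_{I,k+1}}{p_I}\right]^{-1},$$ where $B[a,b]=\Gamma[a]\Gamma[b]/\Gamma[a+b]$.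
   Context: **$L_p$-nested functions.** An $L_p$-nested function $f:\mathbb R^n\to[0,\infty)$ is given by a finite rooted ordered tree whose $n$ leaves, read from left to right, correspond to the coordinates $x_1,\dots,x_n$; every inner node $I$ has $\ell_I\ge 2$ children, denoted $(I,1),\dots,(I,\ell_I)$, and carries an exponent $p_I>0$. Nodes are denoted by multi-indices describing the path from the root; the root is $\emptyset$, and $(\emptyset,k)=k$. For a node $I$, $\boldsymbol x_I$ denotes the coordinates at leaves in the subtree under $I$, $\boldsymbol x_{\widehat I}$ the remaining coordinates, and $n_I$ the number of leaves under $I$ ($n_I=1$ if $I$ is a leaf). Put $f_I(\boldsymbol x_I)=|x_i|$ if $I$ is the leaf of $x_i$, and $f_I(\boldsymbol x_I)=\left(\sum_{k=1}^{\ell_I} f_{I,k}(\boldsymbol x_{I,k})^{p_I}\right)^{1/p_I}$ if $I$ is an inner node; $f=f_\emptyset$. For leaves $I$ one uses the convention $p_I=1$. **Uniform distribution.** The uniform distribution on $\mathbb L_f$ is the distribution of $\boldsymbol X/f(\boldsymbol X)$, where $\boldsymbol X$ is any random vector with a Lebesgue density depending on $\boldsymbol x$ only through $f(\boldsymbol x)$ (for instance, $\boldsymbol X$ uniform on $\{f\le 1\}$); it does not depend on the choice of that density. **The terms $G$.** The leaf of $x_n$ is the rightmost leaf, so each non-root node on its path to the root is the last child $(I,\ell_I)$ of its parent $I$. Set $g_\emptyset=1$ and, recursively down this path, $$g_{I,\ell_I}(\boldsymbol u_{\widehat{I,\ell_I}})=\Big(g_I(\boldsymbol u_{\widehat I})^{p_I}-\sum_{j=1}^{\ell_I-1}f_{I,j}(\boldsymbol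 u_{I,j})^{p_I}\Big)^{1/p_I},\qquad G_{I,\ell_I}(\boldsymbol u_{\widehat{I,\ell_I}})=g_{I,\ell_I}(\boldsymbol u_{\widehat{I,\ell_I}})^{\,p_{I,\ell_I}-p_I}.$$ *)

theory Defs
  imports "HOL-Probability.Probability" "HOL-Library.Sublist"
begin

datatype nested_tree = Leaf | Inner real "nested_tree list"

fun wf_tree :: "nested_tree \<Rightarrow> bool" where
  "wf_tree Leaf \<longleftrightarrow> True"
| "wf_tree (Inner p ts) \<longleftrightarrow> p > 0 \<and> length ts \<ge> 2 \<and> (\<forall>t\<in>set ts. wf_tree t)"

fun nleaves :: "nested_tree \<Rightarrow> nat" where
  "nleaves Leaf = 1"
| "nleaves (Inner p ts) = (\<Sum>t\<leftarrow>ts. nleaves t)"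

lemma size_nth_list_less [termination_simp]:
  "k < length ts \<Longrightarrow> size (ts ! k) < Suc (size_list size ts)"
  using size_list_estimation'[of "ts ! k" ts "size (ts ! k)" size] by (simp add: less_Suc_eq_le)

declare sum.cong [fundef_cong]

text \<open>Coordinates, like list positions, are numbered from 0; the k-th child of an inner node
  owns the block of coordinates that follows the leaves of its left siblings.\<close>

fun Lp_nested :: "nested_tree \<Rightarrow> (nat \<Rightarrow> real) \<Rightarrow> real" where
  "Lp_nested Leaf x = \<bar>x 0\<bar>"
| "Lp_nested (Inner p ts) x =
     (\<Sum>k<length ts.
        Lp_nested (ts ! k) (\<lambda>i. x ((\<Sum>t\<leftarrow>take k ts. nleaves t) + i)) powr p) powr (1 / p)"

text \<open>Multi-indices are lists of child positions read from the root (\<open>[]\<close>) downwards, so that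
  the k-th child of \<open>I\<close> is \<open>I @ [k]\<close>, again with \<open>k\<close> starting from 0.\<close>

fun nodes :: "nested_tree \<Rightarrow> nat list set" where
  "nodes Leaf = {[]}"
| "nodes (Inner p ts) = insert [] (\<Union>k<length ts. (#) k ` nodes (ts ! k))"

fun subtree :: "nested_tree \<Rightarrow> nat list \<Rightarrow> nested_tree" where
  "subtree t [] = t"
| "subtree Leaf (k # I) = Leaf"
| "subtree (Inner p ts) (k # I) = subtree (ts ! k) I"

text \<open>The number of leaves to the left of a node.\<close>

fun offset :: "nested_tree \<Rightarrow> nat list \<Rightarrow> nat" where
  "offset t [] = 0"
| "offset Leaf (k # I) = 0"
| "offset (Inner p ts) (k # I) = (\<Sum>t\<leftarrow>take k ts. nleaves t) + offset (ts ! k) I"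

fun exponent :: "nested_tree \<Rightarrow> real" where
  "exponent Leaf = 1"
| "exponent (Inner p ts) = p"

fun nchildren :: "nested_tree \<Rightarrow> nat" where
  "nchildren Leaf = 0"
| "nchildren (Inner p ts) = length ts"

definition inner_nodes :: "nested_tree \<Rightarrow> nat list set" where
  "inner_nodes t = {I \<in> nodes t. subtree t I \<noteq> Leaf}"

definition node_p :: "nested_tree \<Rightarrow> nat list \<Rightarrow> real" where
  "node_p t I = exponent (subtree t I)"

definition node_l :: "nested_tree \<Rightarrow> nat list \<Rightarrow> nat" where
  "node_l t I = nchildren (subtree t I)"

definition node_n :: "nested_tree \<Rightarrow> nat list \<Rightarrow> nat" where
  "node_n t I = nleaves (subtree t I)"

text \<open>\<open>f\<^sub>I(x\<^sub>I)\<close>, as a function of the full vector \<open>x\<close>.\<close>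

definition node_f :: "nested_tree \<Rightarrow> nat list \<Rightarrow> (nat \<Rightarrow> real) \<Rightarrow> real" where
  "node_f t I x = Lp_nested (subtree t I) (\<lambda>i. x (offset t I + i))"

fun last_leaf :: "nested_tree \<Rightarrow> nat list" where
  "last_leaf Leaf = []"
| "last_leaf (Inner p ts) =
     (if ts = [] then [] else (length ts - 1) # last_leaf (ts ! (length ts - 1)))"

definition last_path :: "nested_tree \<Rightarrow> nat list set" where
  "last_path t = {L. L \<noteq> [] \<and> prefix L (last_leaf t)}"

text \<open>Only meaningful for multi-indices on the path to the last leaf: there the node \<open>I\<close> is the
  last child of its parent \<open>butlast I\<close>, and the sum runs over all its siblings.\<close>

function node_g :: "nested_tree \<Rightarrow> nat list \<Rightarrow> (nat \<Rightarrow> real) \<Rightarrow> real" where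
  "node_g t I u =
     (if I = [] then 1
      else let J = butlast I; p = node_p t J in
        (node_g t J u powr p - (\<Sum>j<node_l t J - 1. node_f t (J @ [j]) u powr p)) powr (1 / p))"
  by pat_completeness auto
termination by (relation "Wellfounded.measure (\<lambda>(t, I, u). length I)") auto

declare node_g.simps [simp del]

definition node_G :: "nested_tree \<Rightarrow> nat list \<Rightarrow> (nat \<Rightarrow> real) \<Rightarrow> real" where
  "node_G t L u = node_g t L u powr (node_p t L - node_p t (butlast L))"

text \<open>With children counted from 0, the Beta factor for \<open>k\<close> has the leaf count of children
  \<open>0, \<dots>, k - 1\<close> in its first and that of child \<open>k\<close> in its second argument.\<close>

definition sphere_density :: "nested_tree \<Rightarrow> (nat \<Rightarrow> real) \<Rightarrow> real" where
  "sphere_density t u =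
     (\<Prod>L\<in>last_path t. node_G t L u) / 2 ^ (nleaves t - 1) *
     (\<Prod>I\<in>inner_nodes t.
        node_p t I ^ (node_l t I - 1) *
        (\<Prod>k=1..node_l t I - 1.
           inverse (Beta ((\<Sum>i<k. real (node_n t (I @ [i]))) / node_p t I)
                         (real (node_n t (I @ [k])) / node_p t I))))"

text \<open>Lebesgue measure on \<open>\<real>\<^sup>n\<close>, with vectors as functions on \<open>{..<n}\<close>.\<close>

abbreviation leb :: "nat \<Rightarrow> (nat \<Rightarrow> real) measure" where
  "leb n \<equiv> Pi\<^sub>M {..<n} (\<lambda>_. lborel)"

text \<open>\<open>\<nu>\<close> is the law of \<open>X / f(X)\<close> for some random vector \<open>X\<close> whose Lebesgue density has the form
  \<open>h(f(x))\<close>. Such a law exists by \<open>sphere_uniform_exists\<close> below; it does not depend on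
  the choice of \<open>h\<close>.\<close>

definition sphere_uniform :: "nested_tree \<Rightarrow> (nat \<Rightarrow> real) measure \<Rightarrow> bool" where
  "sphere_uniform t \<nu> \<longleftrightarrow>
     (\<exists>h :: real \<Rightarrow> ennreal.
        let n = nleaves t; f = Lp_nested t; \<mu> = density (leb n) (\<lambda>x. h (f x)) in
        (\<lambda>x. h (f x)) \<in> borel_measurable (leb n) \<and> prob_space \<mu> \<and>
        \<nu> = distr \<mu> (leb n) (\<lambda>x. \<lambda>i\<in>{..<n}. x i / f x))"

lemma sum_list_take_add_less:
  "k < length ts \<Longrightarrow> i < nleaves (ts ! k) \<Longrightarrow>
   (\<Sum>t\<leftarrow>take k ts. nleaves t) + i < (\<Sum>t\<leftarrow>ts. nleaves t)"
proof -
  assume k: "k < length ts" and i: "i < nleaves (ts ! k)"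
  have "(\<Sum>t\<leftarrow>ts. nleaves t) = (\<Sum>t\<leftarrow>take k ts @ ts ! k # drop (Suc k) ts. nleaves t)"
    using id_take_nth_drop[OF k] by simp
  then show ?thesis using i by simp
qed

lemma Lp_nested_measurable_aux:
  assumes "\<And>i. i < nleaves t \<Longrightarrow> (\<lambda>x. g x i) \<in> borel_measurable M"
  shows "(\<lambda>x. Lp_nested t (g x)) \<in> borel_measurable M"
  using assms
proof (induction t arbitrary: g)
  case Leaf
  then show ?case by simp
next
  case (Inner p ts)
  have "(\<lambda>x. Lp_nested (ts ! k) (\<lambda>i. g x ((\<Sum>t\<leftarrow>take k ts. nleaves t) + i)))
          \<in> borel_measurable M" if "k < length ts" for k
    using that by (intro Inner.IH Inner.prems) (auto intro: sum_list_take_add_less)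
  then show ?case by simp
qed

lemma Lp_nested_measurable [measurable]:
  "Lp_nested t \<in> borel_measurable (leb (nleaves t))"
proof -
  have "(\<lambda>x. x i) \<in> borel_measurable (leb (nleaves t))" if "i < nleaves t" for i
    using measurable_component_singleton[of i "{..<nleaves t}" "\<lambda>_. lborel"] that by simp
  then show ?thesis by (rule Lp_nested_measurable_aux)
qed

lemma Lp_nested_nonneg: "Lp_nested t x \<ge> 0"
  by (cases t) auto

lemma le_Lp_nested:
  "wf_tree t \<Longrightarrow> i < nleaves t \<Longrightarrow> \<bar>x i\<bar> \<le> Lp_nested t x"
proof (induction t arbitrary: x i)
  case Leaf
  then show ?case by simp
next
  case (Inner p ts)
  define s where "s k = (\<Sum>t\<leftarrow>take k ts. nleaves t)" for k
  have ex: "\<exists>k<length us. (\<Sum>t\<leftarrow>take k us. nleaves t) \<le> i \<and>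
              i < (\<Sum>t\<leftarrow>take k us. nleaves t) + nleaves (us ! k)"
    if "i < (\<Sum>t\<leftarrow>us. nleaves t)" for us
    using that
  proof (induction us rule: rev_induct)
    case (snoc u us)
    show ?case
    proof (cases "i < (\<Sum>t\<leftarrow>us. nleaves t)")
      case True
      from snoc.IH[OF this] obtain k where k: "k < length us"
        "(\<Sum>t\<leftarrow>take k us. nleaves t) \<le> i"
        "i < (\<Sum>t\<leftarrow>take k us. nleaves t) + nleaves (us ! k)"
        by blast
      then show ?thesis
        by (intro exI[of _ k]) (simp add: nth_append)
    next
      case False
      with snoc.prems show ?thesis
        by (intro exI[of _ "length us"]) auto
    qed
  qed simp
  obtain k where k: "k < length ts" "s k \<le> i" "i < s k + nleaves (ts ! k)"
    using ex[of ts] Inner.prems by (auto simp: s_def)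
  let ?F = "\<lambda>k. Lp_nested (ts ! k) (\<lambda>i. x (s k + i))"
  have "\<bar>x i\<bar> \<le> ?F k"
    using Inner.IH[of "ts ! k" "i - s k" "\<lambda>i. x (s k + i)"] k Inner.prems by auto
  also have "?F k = (?F k powr p) powr (1 / p)"
    using Inner.prems Lp_nested_nonneg by (simp add: powr_powr)
  also have "\<dots> \<le> (\<Sum>k<length ts. ?F k powr p) powr (1 / p)"
    using k Inner.prems by (intro powr_mono2 member_le_sum) auto
  also have "\<dots> = Lp_nested (Inner p ts) x" by (simp add: s_def)
  finally show ?case .
qed

lemma Lp_nested_small:
  "wf_tree t \<Longrightarrow> e > 0 \<Longrightarrow>
   \<exists>d>0. \<forall>x. (\<forall>i<nleaves t. \<bar>x i\<bar> \<le> d) \<longrightarrow> Lp_nested t x \<le> e"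
proof (induction t arbitrary: e)
  case Leaf
  then show ?case by auto
next
  case (Inner p ts)
  define l where "l = length ts"
  define e' where "e' = (e powr p / l) powr (1 / p)"
  have p: "p > 0" and l: "l \<ge> 2" using Inner.prems by (auto simp: l_def)
  have e': "e' > 0" "e' powr p = e powr p / l"
    using p l Inner.prems by (auto simp: e'_def powr_powr)
  have "\<exists>d>0. \<forall>x. (\<forall>i<nleaves (ts ! k). \<bar>x i\<bar> \<le> d) \<longrightarrow> Lp_nested (ts ! k) x \<le> e'"
    if "k < l" for k
    using that e' Inner.prems by (intro Inner.IH) (auto simp: l_def)
  then obtain D where D: "\<And>k. k < l \<Longrightarrow> D k > 0"
    "\<And>k x. k < l \<Longrightarrow> (\<forall>i<nleaves (ts ! k). \<bar>x i\<bar> \<le> D k) \<Longrightarrow> Lp_nested (ts ! k) x \<le> e'"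
    by metis
  define d where "d = Min (D ` {..<l})"
  have ne: "D ` {..<l} \<noteq> {}" using l by (auto simp: lessThan_empty_iff)
  have d: "d > 0" "d \<le> D k" if "k < l" for k
    using that D ne by (auto simp: d_def)
  show ?case
  proof (intro exI[of _ d] conjI allI impI)
    show "d > 0" using d[of 0] l by simp
    fix x assume x: "\<forall>i<nleaves (Inner p ts). \<bar>x i\<bar> \<le> d"
    let ?F = "\<lambda>k. Lp_nested (ts ! k) (\<lambda>i. x ((\<Sum>t\<leftarrow>take k ts. nleaves t) + i))"
    have F: "?F k \<le> e'" if "k < l" for k
    proof (rule D(2)[OF that], intro allI impI)
      fix i assume "i < nleaves (ts ! k)"
      then have "\<bar>x ((\<Sum>t\<leftarrow>take k ts. nleaves t) + i)\<bar> \<le> d"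
        using x that sum_list_take_add_less[of k ts i] by (auto simp: l_def)
      then show "\<bar>x ((\<Sum>t\<leftarrow>take k ts. nleaves t) + i)\<bar> \<le> D k"
        using d(2)[OF that] by linarith
    qed
    have "(\<Sum>k<l. ?F k powr p) \<le> (\<Sum>k<l. e' powr p)"
      using F p Lp_nested_nonneg by (intro sum_mono powr_mono2) auto
    also have "\<dots> = e powr p" using l e' by simp
    finally have "(\<Sum>k<l. ?F k powr p) powr (1 / p) \<le> (e powr p) powr (1 / p)"
      using p by (intro powr_mono2 sum_nonneg) auto
    then show "Lp_nested (Inner p ts) x \<le> e"
      using p Inner.prems by (simp add: l_def powr_powr)
  qed
qed

lemma sphere_uniform_exists:
  assumes "wf_tree t"
  shows "\<exists>\<nu>. sphere_uniform t \<nu>"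
proof -
  interpret product_sigma_finite "\<lambda>_::nat. lborel :: real measure" ..
  define n where "n = nleaves t"
  define S where "S = {x \<in> space (leb n). Lp_nested t x \<le> 1}"
  have [measurable]: "Lp_nested t \<in> borel_measurable (leb n)"
    by (simp add: n_def)
  have S [measurable]: "S \<in> sets (leb n)"
    unfolding S_def by measurable
  have box: "emeasure (leb n) (Pi\<^sub>E {..<n} (\<lambda>_. {-c..c})) = ennreal (2 * c) ^ n"
    if "c > 0" for c :: real
    using that by (subst emeasure_PiM) auto
  have box_in: "Pi\<^sub>E {..<n} (\<lambda>_. {-c..c}) \<in> sets (leb n)" for c :: real
    by (intro sets_PiM_I_finite) auto
  have "S \<subseteq> Pi\<^sub>E {..<n} (\<lambda>_. {-1..1})"
  proof
    fix x assume x: "x \<in> S"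
    have "\<bar>x i\<bar> \<le> 1" if "i < n" for i
      using le_Lp_nested[OF assms, of i x] x that by (auto simp: S_def n_def)
    then show "x \<in> Pi\<^sub>E {..<n} (\<lambda>_. {-1..1})"
      using x by (auto simp: S_def space_PiM PiE_iff abs_le_iff minus_le_iff)
  qed
  then have "emeasure (leb n) S \<le> ennreal (2 * 1) ^ n"
    using emeasure_mono[OF _ box_in, of S 1] box[of 1] by simp
  then have fin: "emeasure (leb n) S \<noteq> \<infinity>"
    by (metis ennreal_power ennreal_less_top infinity_ennreal_def leD zero_le_mult_iff
        zero_le_numeral zero_le_one)
  obtain d where d: "d > 0" "\<And>x. (\<forall>i<n. \<bar>x i\<bar> \<le> d) \<Longrightarrow> Lp_nested t x \<le> 1"
    using Lp_nested_small[OF assms, of 1] by (auto simp: n_def)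
  have "Pi\<^sub>E {..<n} (\<lambda>_. {-d..d}) \<subseteq> S"
    using d by (fastforce simp: S_def space_PiM PiE_iff abs_le_iff)
  then have "ennreal (2 * d) ^ n \<le> emeasure (leb n) S"
    by (metis emeasure_mono S box d(1))
  then have pos: "emeasure (leb n) S \<noteq> 0"
    using d(1) by (auto simp: ennreal_power)
  define h :: "real \<Rightarrow> ennreal" where
    "h r = indicator {..1} r / emeasure (leb n) S" for r
  have meas: "(\<lambda>x. h (Lp_nested t x)) \<in> borel_measurable (leb n)"
    unfolding h_def by measurable
  have "density (leb n) (\<lambda>x. h (Lp_nested t x)) = uniform_measure (leb n) S"
    unfolding uniform_measure_def using meas
    by (intro density_cong AE_I2) (auto simp: h_def S_def indicator_def)
  then have "prob_space (density (leb n) (\<lambda>x. h (Lp_nested t x)))"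
    using prob_space_uniform_measure[OF pos fin] by simp
  with meas show ?thesis
    unfolding sphere_uniform_def Let_def n_def by blast
qed

end

theory Submission
  imports Defs
begin

text \<open>For fixed first coordinates \<open>x\<^sub>1, \<dots>, x\<^sub>n\<^sub>-\<^sub>1\<close>, substituting the value \<open>r = f(x)\<close> for
  \<open>x\<^sub>n > 0\<close> node by node along the path to the last leaf produces the factors \<open>G\<close>, with the
  root value 1 replaced by \<open>r\<close>. This Jacobian is homogeneous of degree 0, so exchanging the
  integrals and rescaling the first coordinates by \<open>r\<close> separates the radius from the
  projected point \<open>u = x / r\<close>, whatever the radial density. The normalising constant comes from
  the law of the radius: integrating \<open>\<phi>(f(x))\<close> over \<open>\<real>\<^sup>n\<close> gives a constant times the
  integral of \<open>\<phi>(r) r\<^sup>n\<^sup>-\<^sup>1\<close>, and adding the children of each inner node one at a time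
  contributes one Beta integral each.\<close>

subsection \<open>One-dimensional substitutions\<close>

text \<open>The substitution closes up along the path because of how exponents combine. Between the
  radius \<open>s\<close> of a child with exponent \<open>q\<close> and the radius \<open>r\<close>
  of its parent with exponent \<open>p\<close>,
  \<open>ds = s powr (1 - p) * r powr (p - 1) dr\<close>. The child has already left a factor
  \<open>s powr (q - 1)\<close>; together they give \<open>s powr (q - p)\<close>, the child's
  factor G, while \<open>r powr (p - 1)\<close> is left for the next step up. The convention that
  leaves have exponent 1 starts this recursion. At the root the leftover belongs to the Jacobian:
  the product of the G alone has degree \<open>1 - exponent t\<close>, and only with
  \<open>r powr (exponent t - 1)\<close> does it get degree 0. Of the radial density only its
  integral against \<open>r powr (n - 1)\<close> enters, and total mass 1 fixes it as
  \<open>1 / radial_const t\<close>. So the density is \<open>2 / radial_const t\<close> times the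
  Jacobian at radius 1. This 2 counts the signs of the last coordinate; each of the n leaves puts a
  2 into \<open>radial_const t\<close>, whence \<open>2 ^ (n - 1)\<close>. All integrals take values
  in [0, \<infinity>], so no integrability has to be shown before exchanging them.\<close>

text \<open>Measurability is asked of the truncated integrands only, because in the application the
  integrand is controlled on compact subintervals and arbitrary elsewhere.\<close>

lemma nn_integral_SUP_indicator:
  fixes h :: "'a \<Rightarrow> ennreal"
  assumes "incseq A" "\<And>i. (\<lambda>x. h x * indicator (A i) x) \<in> borel_measurable M"
  shows "(\<integral>\<^sup>+x. h x * indicator (\<Union>i. A i) x \<partial>M) =
         (SUP i. \<integral>\<^sup>+x. h x * indicator (A i) x \<partial>M)"
proof -
  have "h x * indicator (\<Union>i. A i) x = (SUP i. h x * indicator (A i) x)" for x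
  proof (cases "x \<in> (\<Union>i. A i)")
    case True
    then obtain i where i: "x \<in> A i" by blast
    show ?thesis
      by (rule antisym) (use i in \<open>auto intro!: SUP_least SUP_upper2[of i] simp: indicator_def\<close>)
  qed (auto simp: indicator_def)
  moreover have "incseq (\<lambda>i x. h x * indicator (A i) x)"
    using assms(1) by (auto simp: incseq_def le_fun_def indicator_def)
  ultimately show ?thesis
    using assms(2) by (simp add: nn_integral_monotone_convergence_SUP)
qed

text \<open>Exhausting the open interval by compact ones admits infinite endpoints and derivatives
  that blow up at an endpoint. Both occur below: \<open>r\<close> runs to infinity, and
  \<open>(r powr p - A) powr ((1 - p)/p)\<close> is singular at the lower end when
  \<open>p > 1\<close> and the lower limit for the child is 0.\<close>

lemma nn_integral_substitution_einterval:
  fixes f :: "real \<Rightarrow> ennreal" and g g' :: "real \<Rightarrow> real" and a b :: ereal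
  assumes f [measurable]: "f \<in> borel_measurable borel"
    and deriv: "\<And>x. x \<in> einterval a b \<Longrightarrow> (g has_real_derivative g' x) (at x)"
    and cont: "continuous_on (einterval a b) g'"
    and nonneg: "\<And>x. x \<in> einterval a b \<Longrightarrow> g' x \<ge> 0"
    and ab: "a < b"
  shows "(\<integral>\<^sup>+x. f x * indicator (g ` einterval a b) x \<partial>lborel) =
         (\<integral>\<^sup>+x. f (g x) * ennreal (g' x) * indicator (einterval a b) x \<partial>lborel)"
proof -
  obtain u l :: "nat \<Rightarrow> real" where ul: "einterval a b = (\<Union>i. {l i..u i})" "incseq u"
    "decseq l" "\<And>i. l i < u i" and "\<And>i. a < l i" "\<And>i. u i < b" "l \<longlonglongrightarrow> a" "u \<longlonglongrightarrow> b"
    by (rule einterval_Icc_approximation[OF ab], rule that)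
  have sub: "{l i..u i} \<subseteq> einterval a b" for i using ul(1) by blast
  have deriv': "(g has_real_derivative g' x) (at x)" "g' x \<ge> 0" if "x \<in> {l i..u i}" for x i
    using deriv nonneg sub that by blast+
  have contg': "continuous_on {l i..u i} g'" for i
    using cont sub continuous_on_subset by blast
  have contg: "continuous_on {l i..u i} g" for i
    using deriv' has_real_derivative_imp_continuous_on[of "{l i..u i}" g g'] by blast
  have mono: "g x \<le> g y" if "l i \<le> x" "x \<le> y" "y \<le> u i" for x y i
    using that deriv'[of _ i] by (intro deriv_nonneg_imp_mono[of x y g g']) auto
  have img: "g ` {l i..u i} = {g (l i)..g (u i)}" for i
  proof
    show "g ` {l i..u i} \<subseteq> {g (l i)..g (u i)}" using mono[of i] by auto
    show "{g (l i)..g (u i)} \<subseteq> g ` {l i..u i}"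
      using IVT'[of g "l i" _ "u i"] contg[of i] ul(4)[of i] by force
  qed
  have inc: "incseq (\<lambda>i. {l i..u i})" 
    using ul(2,3) by (force simp: incseq_def decseq_def intro: order_trans)
  have inc': "incseq (\<lambda>i. g ` {l i..u i})"
    using inc unfolding incseq_def by (meson image_mono)
  have meas: "(\<lambda>x. f (g x) * ennreal (g' x) * indicator {l i..u i} x) \<in> borel_measurable lborel"
    for i
  proof -
    \<comment> \<open>Outside the interval \<open>g\<close> and \<open>g'\<close> may fail to be
      measurable, so both are cut off to the compact piece on which they are continuous.\<close>
    have [measurable]: "(\<lambda>x. indicator {l i..u i} x *\<^sub>R g x) \<in> borel_measurable borel"
      "(\<lambda>x. indicator {l i..u i} x *\<^sub>R g' x) \<in> borel_measurable borel"
      by (rule borel_measurable_continuous_on_indicator; use contg contg' in simp)+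
    have "(\<lambda>x. f (g x) * ennreal (g' x) * indicator {l i..u i} x) =
      (\<lambda>x. f (indicator {l i..u i} x *\<^sub>R g x) * ennreal (indicator {l i..u i} x *\<^sub>R g' x) *
            indicator {l i..u i} x)"
      by (auto simp: indicator_def fun_eq_iff)
    also have "\<dots> \<in> borel_measurable lborel" by measurable
    finally show ?thesis .
  qed
  have "(\<integral>\<^sup>+x. f x * indicator (g ` einterval a b) x \<partial>lborel) =
        (SUP i. \<integral>\<^sup>+x. f x * indicator (g ` {l i..u i}) x \<partial>lborel)"
    unfolding ul(1) image_UN using inc' by (rule nn_integral_SUP_indicator) (simp add: img)
  also have "\<dots> = (SUP i. \<integral>\<^sup>+x. f (g x) * ennreal (g' x) * indicator {l i..u i} x \<partial>lborel)"
    unfolding img using deriv' contg' ul(4)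
    by (intro SUP_cong refl nn_integral_substitution_aux) auto
  also have "\<dots> = (\<integral>\<^sup>+x. f (g x) * ennreal (g' x) * indicator (einterval a b) x \<partial>lborel)"
    unfolding ul(1) using inc meas by (rule nn_integral_SUP_indicator[symmetric])
  finally show ?thesis .
qed

text \<open>One level of the tree: \<open>s\<close> is the radius at the last child,
  \<open>r\<close> the radius at its parent, and \<open>A\<close> the sum of the \<open>p\<close>-th
  powers of the other children. The bound \<open>b\<close> will be the child's norm when the last
  coordinate is 0.\<close>

lemma nn_integral_substitution_powr_diff:
  fixes F :: "real \<Rightarrow> ennreal"
  assumes [measurable]: "F \<in> borel_measurable borel" and p: "p > 0" and A: "A \<ge> 0" and b: "b \<ge> 0"
  shows "(\<integral>\<^sup>+s. F s * indicator {b<..} s \<partial>lborel) =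
    (\<integral>\<^sup>+r. F ((r powr p - A) powr (1/p)) *
       ennreal ((r powr p - A) powr ((1 - p)/p) * r powr (p - 1)) *
       indicator {(A + b powr p) powr (1/p)<..} r \<partial>lborel)"
proof -
  define c where "c = (A + b powr p) powr (1/p)"
  define g where "g r = (r powr p - A) powr (1/p)" for r
  have c: "c \<ge> 0" "c powr p = A + b powr p"
    using p A by (auto simp: c_def powr_powr)
  have pos: "r powr p - A > b powr p" "r > 0" if "c < r" for r
    using powr_less_mono2[OF p c(1) that] c that by auto
  have pos': "r powr p - A > 0" if "c < r" for r
    using pos[OF that] powr_ge_zero[of b p] by linarith
  have deriv: "(g has_real_derivative (r powr p - A) powr ((1 - p)/p) * r powr (p - 1)) (at r)"
    if "c < r" for r
  proof -
    have e: "1/p - 1 = (1 - p)/p" using p by (simp add: field_simps)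
    have d: "((\<lambda>r. r powr p - A) has_real_derivative p * r powr (p - 1)) (at r)"
      using DERIV_diff[OF has_real_derivative_powr[OF pos(2)[OF that], of p] DERIV_const] by simp
    show ?thesis
      using DERIV_fun_powr[OF d pos'[OF that], of "1/p"] p e unfolding g_def
      by (simp add: ac_simps)
  qed
  have cont: "continuous_on {c<..} (\<lambda>r. (r powr p - A) powr ((1 - p)/p) * r powr (p - 1))"
    using pos(2) pos' by (intro continuous_intros) (force simp: less_imp_neq)+
  have img: "g ` {c<..} = {b<..}"
  proof (intro equalityI subsetI)
    fix s assume "s \<in> g ` {c<..}"
    then obtain r where r: "r > c" "s = g r" by auto
    have "(b powr p) powr (1/p) < (r powr p - A) powr (1/p)"
      using pos[OF r(1)] p by (intro powr_less_mono2) auto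
    then show "s \<in> {b<..}" using r p b by (simp add: g_def powr_powr)
  next
    fix s assume "s \<in> {b<..}"
    then have s: "s > b" "s > 0" using b by auto
    define r where "r = (A + s powr p) powr (1/p)"
    have "g r = s" using p s A by (simp add: g_def r_def powr_powr)
    moreover have "r > c" unfolding r_def c_def
      using p A b s by (intro powr_less_mono2 add_strict_left_mono) auto
    ultimately show "s \<in> g ` {c<..}" by force
  qed
  have ei: "einterval (ereal c) \<infinity> = {c<..}" by (auto simp: einterval_def)
  show ?thesis
    using nn_integral_substitution_einterval[of F "ereal c" \<infinity> g] deriv cont p A
    unfolding ei img by (simp add: g_def c_def)
qed

text \<open>Substituting \<open>w = v powr (1/p)\<close> gives the standard Beta integral; the
  factor \<open>1 / p\<close> is the constant in the derivative of this power.\<close>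

lemma nn_integral_Beta_powr:
  fixes p \<alpha> \<beta> :: real
  assumes p: "p > 0" and "\<alpha> > 0" "\<beta> > 0"
  shows "(\<integral>\<^sup>+w. ennreal (w powr (\<alpha> - 1) * (1 - w powr p) powr (\<beta>/p - 1)) *
           indicator {0<..<1} w \<partial>lborel) = ennreal (Beta (\<alpha>/p) (\<beta>/p) / p)"
proof -
  define g where "g v = v powr (1/p)" for v :: real
  have deriv: "(g has_real_derivative v powr (1/p - 1) / p) (at v)" if "v \<in> {0<..<1}" for v
    using has_real_derivative_powr[of v "1/p"] that unfolding g_def by simp
  have cont: "continuous_on {0<..<1} (\<lambda>v. v powr (1/p - 1) / p)"
    by (intro continuous_intros) (use p in auto)
  have img: "g ` {0<..<1} = {0<..<1}"
  proof (intro equalityI subsetI)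
    fix s assume "s \<in> g ` {0<..<1}"
    then obtain v where v: "0 < v" "v < 1" "s = v powr (1/p)" by (auto simp: g_def)
    then show "s \<in> {0<..<1}" using powr_less_mono2[of "1/p" v 1] p by auto
  next
    fix s :: real assume s: "s \<in> {0<..<1}"
    have "s = g (s powr p)" using s p by (simp add: g_def powr_powr)
    moreover have "s powr p \<in> {0<..<1}" using s powr_less_mono2[of p s 1] p by auto
    ultimately show "s \<in> g ` {0<..<1}" by blast
  qed
  have ei: "einterval (ereal 0) (ereal 1) = {0<..<1}" by (auto simp: einterval_def)
  let ?B = "\<lambda>v. v powr (\<alpha>/p - 1) * (1 - v) powr (\<beta>/p - 1)"
  have "(\<integral>\<^sup>+w. ennreal (w powr (\<alpha> - 1) * (1 - w powr p) powr (\<beta>/p - 1)) *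
           indicator {0<..<1} w \<partial>lborel) =
        (\<integral>\<^sup>+v. ennreal (g v powr (\<alpha> - 1) * (1 - g v powr p) powr (\<beta>/p - 1)) *
           ennreal (v powr (1/p - 1) / p) * indicator {0<..<1} v \<partial>lborel)"
    using nn_integral_substitution_einterval[of
        "\<lambda>w. ennreal (w powr (\<alpha> - 1) * (1 - w powr p) powr (\<beta>/p - 1))" "ereal 0" "ereal 1" g]
      deriv cont p unfolding ei img by simp
  also have "\<dots> = (\<integral>\<^sup>+v. ennreal (?B v / p) * indicator {0<..<1} v \<partial>lborel)"
  proof (intro nn_integral_cong)
    fix v :: real
    show "ennreal (g v powr (\<alpha> - 1) * (1 - g v powr p) powr (\<beta>/p - 1)) *
           ennreal (v powr (1/p - 1) / p) * indicator {0<..<1} v =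
         ennreal (?B v / p) * indicator {0<..<1} v"
    proof (cases "v \<in> {0<..<1}")
      case True
      have "g v powr (\<alpha> - 1) * v powr (1/p - 1) = v powr (\<alpha>/p - 1)"
        by (simp add: g_def powr_powr powr_add[symmetric] diff_divide_distrib)
      moreover have "g v powr p = v" using True p by (simp add: g_def powr_powr)
      ultimately have "g v powr (\<alpha> - 1) * (1 - g v powr p) powr (\<beta>/p - 1) *
           (v powr (1/p - 1) / p) = ?B v / p"
        by (simp add: mult.assoc mult.commute mult.left_commute)
      then show ?thesis by (simp only: ennreal_mult'[symmetric, OF mult_nonneg_nonneg] powr_ge_zero)
    qed auto
  qed
  also have "\<dots> = ennreal (Beta (\<alpha>/p) (\<beta>/p) / p)"
  proof (rule nn_integral_has_integral_lebesgue')
    have "(?B has_integral Beta (\<alpha>/p) (\<beta>/p)) {0<..<1}"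
      using has_integral_Beta_real[of "\<alpha>/p" "\<beta>/p"] assms by (simp add: has_integral_Icc_iff_Ioo)
    then show "((\<lambda>v. ?B v / p) has_integral Beta (\<alpha>/p) (\<beta>/p) / p) {0<..<1}"
      by (rule has_integral_divide)
  qed (use p in auto)
  finally show ?thesis .
qed

lemma nn_integral_scale:
  fixes F :: "real \<Rightarrow> ennreal"
  assumes [measurable]: "F \<in> borel_measurable borel" and "r > 0"
  shows "(\<integral>\<^sup>+a. F a \<partial>lborel) = ennreal r * (\<integral>\<^sup>+w. F (r * w) \<partial>lborel)"
  using nn_integral_real_affine[of F r 0] assms by simp

text \<open>Proved by substituting for \<open>b\<close> the value \<open>r\<close> of the norm of \<open>(a, b)\<close>, exchanging the
  integrals, and scaling \<open>a = r w\<close>.\<close>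

lemma nn_integral_Lp_combine:
  fixes \<phi> :: "real \<Rightarrow> ennreal"
  assumes [measurable]: "\<phi> \<in> borel_measurable borel" and p: "p > 0" and \<alpha>: "\<alpha> > 0" and \<beta>: "\<beta> > 0"
  shows "(\<integral>\<^sup>+a. (\<integral>\<^sup>+b. \<phi> ((a powr p + b powr p) powr (1/p)) * ennreal (b powr (\<beta> - 1)) *
            indicator {0<..} b \<partial>lborel) * ennreal (a powr (\<alpha> - 1)) * indicator {0<..} a \<partial>lborel)
       = ennreal (Beta (\<alpha>/p) (\<beta>/p) / p) *
         (\<integral>\<^sup>+r. \<phi> r * ennreal (r powr (\<alpha> + \<beta> - 1)) * indicator {0<..} r \<partial>lborel)"
proof -
  \<comment> \<open>The region \<open>0 < a < r\<close> is built into one function of both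
    variables, so that the exchange of integrals is over the whole plane.\<close>
  define H where "H a r = (if 0 < a \<and> a < r then \<phi> r * ennreal (a powr (\<alpha> - 1) *
       (r powr p - a powr p) powr (\<beta>/p - 1) * r powr (p - 1)) else 0)" for a r
  have inner: "(\<integral>\<^sup>+b. \<phi> ((a powr p + b powr p) powr (1/p)) * ennreal (b powr (\<beta> - 1)) *
            indicator {0<..} b \<partial>lborel) * ennreal (a powr (\<alpha> - 1)) * indicator {0<..} a =
        (\<integral>\<^sup>+r. H a r \<partial>lborel)" for a
  proof (cases "a > 0")
    case True
    have "(\<integral>\<^sup>+b. \<phi> ((a powr p + b powr p) powr (1/p)) * ennreal (b powr (\<beta> - 1)) *
            indicator {0<..} b \<partial>lborel) =
          (\<integral>\<^sup>+r. \<phi> ((a powr p + ((r powr p - a powr p) powr (1/p)) powr p) powr (1/p)) *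
               ennreal (((r powr p - a powr p) powr (1/p)) powr (\<beta> - 1)) *
               ennreal ((r powr p - a powr p) powr ((1 - p)/p) * r powr (p - 1)) *
               indicator {a<..} r \<partial>lborel)"
      using nn_integral_substitution_powr_diff[of "\<lambda>b. \<phi> ((a powr p + b powr p) powr (1/p)) *
          ennreal (b powr (\<beta> - 1))" p "a powr p" 0] p True
      by (simp add: powr_powr)
    also have "\<dots> = (\<integral>\<^sup>+r. \<phi> r * ennreal ((r powr p - a powr p) powr (\<beta>/p - 1) * r powr (p - 1)) *
               indicator {a<..} r \<partial>lborel)"
    proof (intro nn_integral_cong)
      fix r :: real
      show "\<phi> ((a powr p + ((r powr p - a powr p) powr (1/p)) powr p) powr (1/p)) *
               ennreal (((r powr p - a powr p) powr (1/p)) powr (\<beta> - 1)) *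
               ennreal ((r powr p - a powr p) powr ((1 - p)/p) * r powr (p - 1)) *
               indicator {a<..} r =
            \<phi> r * ennreal ((r powr p - a powr p) powr (\<beta>/p - 1) * r powr (p - 1)) *
               indicator {a<..} r"
      proof (cases "a < r")
        case r: True
        have d: "r powr p - a powr p > 0" using powr_less_mono2[OF p _ r] True by simp
        have "(a powr p + ((r powr p - a powr p) powr (1/p)) powr p) powr (1/p) = r"
          using d p True r by (simp add: powr_powr)
        moreover have "((r powr p - a powr p) powr (1/p)) powr (\<beta> - 1) *
             (r powr p - a powr p) powr ((1 - p)/p) = (r powr p - a powr p) powr (\<beta>/p - 1)"
          using p by (simp add: powr_powr powr_add[symmetric] diff_divide_distrib)
        moreover have "ennreal (((r powr p - a powr p) powr (1/p)) powr (\<beta> - 1)) *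
               ennreal ((r powr p - a powr p) powr ((1 - p)/p) * r powr (p - 1)) =
            ennreal (((r powr p - a powr p) powr (1/p)) powr (\<beta> - 1) *
             (r powr p - a powr p) powr ((1 - p)/p) * r powr (p - 1))"
          by (subst ennreal_mult'[symmetric]) (simp_all only: powr_ge_zero mult.assoc)
        ultimately show ?thesis by (simp only: mult.assoc)
      qed auto
    qed
    finally have "(\<integral>\<^sup>+b. \<phi> ((a powr p + b powr p) powr (1/p)) * ennreal (b powr (\<beta> - 1)) *
            indicator {0<..} b \<partial>lborel) * ennreal (a powr (\<alpha> - 1)) =
        (\<integral>\<^sup>+r. \<phi> r * ennreal ((r powr p - a powr p) powr (\<beta>/p - 1) * r powr (p - 1)) *
               indicator {a<..} r * ennreal (a powr (\<alpha> - 1)) \<partial>lborel)"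
      by (simp add: nn_integral_multc)
    also have "\<dots> = (\<integral>\<^sup>+r. H a r \<partial>lborel)"
      using True by (intro nn_integral_cong) (simp add: H_def ennreal_mult' mult_ac indicator_def)
    finally have "(\<integral>\<^sup>+b. \<phi> ((a powr p + b powr p) powr (1/p)) * ennreal (b powr (\<beta> - 1)) *
            indicator {0<..} b \<partial>lborel) * ennreal (a powr (\<alpha> - 1)) = (\<integral>\<^sup>+r. H a r \<partial>lborel)" .
    moreover have "indicator {0<..} a = (1 :: ennreal)" using True by simp
    ultimately show ?thesis by (simp only: mult_1_right)
  next
    case False
    then show ?thesis by (simp add: H_def)
  qed
  have outer: "(\<integral>\<^sup>+a. H a r \<partial>lborel) =
        ennreal (Beta (\<alpha>/p) (\<beta>/p) / p) *
        (\<phi> r * ennreal (r powr (\<alpha> + \<beta> - 1)) * indicator {0<..} r)" for r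
  proof (cases "r > 0")
    case True
    have "(\<integral>\<^sup>+a. H a r \<partial>lborel) = ennreal r * (\<integral>\<^sup>+w. H (r * w) r \<partial>lborel)"
    proof (rule nn_integral_scale[of "\<lambda>a. H a r" r])
      show "(\<lambda>a. H a r) \<in> borel_measurable borel"
        unfolding H_def by measurable
    qed (rule True)
    also have "(\<integral>\<^sup>+w. H (r * w) r \<partial>lborel) =
      (\<integral>\<^sup>+w. \<phi> r * ennreal (r powr (\<alpha> + \<beta> - 2)) *
          (ennreal (w powr (\<alpha> - 1) * (1 - w powr p) powr (\<beta>/p - 1)) *
           indicator {0<..<1} w) \<partial>lborel)"
    proof (intro nn_integral_cong)
      fix w :: real
      have e1: "r powr p - (r * w) powr p = r powr p * (1 - w powr p)"
        by (simp add: powr_mult algebra_simps)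
      have e2: "p * (\<beta>/p - 1) = \<beta> - p" using p by (simp add: right_diff_distrib)
      \<comment> \<open>The integrand scales with degree \<open>\<alpha> + \<beta> - 2\<close>; the
        missing power of \<open>r\<close> is the factor in front, from scaling
        \<open>a = r w\<close>.\<close>
      have e3: "r powr (\<alpha> + \<beta> - 2) = r powr (\<alpha> - 1) * r powr (\<beta> - p) * r powr (p - 1)"
        unfolding powr_add[symmetric] by (rule arg_cong[of _ _ "(powr) r"]) simp
      have "(r * w) powr (\<alpha> - 1) * (r powr p - (r * w) powr p) powr (\<beta>/p - 1) *
         r powr (p - 1) = r powr (\<alpha> + \<beta> - 2) * (w powr (\<alpha> - 1) * (1 - w powr p) powr (\<beta>/p - 1))"
        unfolding e1 e3 unfolding powr_mult powr_powr e2 by (simp only: mult_ac)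
      moreover have "0 < r * w \<and> r * w < r \<longleftrightarrow> 0 < w \<and> w < 1"
        using True by (auto simp: zero_less_mult_iff)
      ultimately show "H (r * w) r = \<phi> r * ennreal (r powr (\<alpha> + \<beta> - 2)) *
          (ennreal (w powr (\<alpha> - 1) * (1 - w powr p) powr (\<beta>/p - 1)) * indicator {0<..<1} w)"
        by (simp add: H_def ennreal_mult' mult.assoc)
    qed
    also have "\<dots> = \<phi> r * ennreal (r powr (\<alpha> + \<beta> - 2)) * ennreal (Beta (\<alpha>/p) (\<beta>/p) / p)"
      by (subst nn_integral_cmult) (simp_all add: nn_integral_Beta_powr p \<alpha> \<beta>)
    also have "ennreal r * \<dots> = ennreal (Beta (\<alpha>/p) (\<beta>/p) / p) *
        (\<phi> r * ennreal (r * r powr (\<alpha> + \<beta> - 2)))"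
      using True by (simp add: ennreal_mult' ac_simps)
    also have "r * r powr (\<alpha> + \<beta> - 2) = r powr (\<alpha> + \<beta> - 1)"
      using True by (simp add: powr_mult_base)
    finally show ?thesis using True by simp
  next
    case False
    then have "H a r = 0" for a by (auto simp: H_def indicator_def)
    then show ?thesis using False by simp
  qed
  have swap: "(\<integral>\<^sup>+a. (\<integral>\<^sup>+r. H a r \<partial>lborel) \<partial>lborel) = (\<integral>\<^sup>+r. (\<integral>\<^sup>+a. H a r \<partial>lborel) \<partial>lborel)"
  proof (rule pair_sigma_finite.Fubini'[symmetric])
    show "pair_sigma_finite (lborel :: real measure) (lborel :: real measure)"
      by (intro pair_sigma_finite.intro lborel.sigma_finite_measure_axioms)
    show "(\<lambda>(a, r). H a r) \<in> borel_measurable (lborel \<Otimes>\<^sub>M lborel)"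
      unfolding H_def by measurable
  qed
  have m: "(\<lambda>r. \<phi> r * ennreal (r powr (\<alpha> + \<beta> - 1)) * indicator {0<..} r)
      \<in> borel_measurable lborel"
    by measurable
  show ?thesis
    using swap unfolding inner outer nn_integral_cmult[OF m] .
qed

subsection \<open>Integration on \<open>\<real>\<^sup>n\<close>\<close>

abbreviation left_leaves :: "nested_tree list \<Rightarrow> nat \<Rightarrow> nat" where
  "left_leaves ts k \<equiv> (\<Sum>t\<leftarrow>take k ts. nleaves t)"

section \<open>Locality and homogeneity of the nested norm\<close>

lemma nleaves_pos: "wf_tree t \<Longrightarrow> nleaves t \<ge> 1"
proof (induction t)
  case (Inner p ts)
  then obtain t ts' where "ts = t # ts'" by (cases ts) auto
  with Inner show ?case by fastforce
qed simp

text \<open>Absolute values make this cover the reflection of the last coordinate as well, which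
  later halves the integral over that coordinate.\<close>

lemma Lp_nested_cong_abs:
  "(\<And>i. i < nleaves t \<Longrightarrow> \<bar>x i\<bar> = \<bar>y i\<bar>) \<Longrightarrow> Lp_nested t x = Lp_nested t y"
proof (induction t arbitrary: x y)
  case (Inner p ts)
  have "Lp_nested (ts ! k) (\<lambda>i. x (left_leaves ts k + i)) =
        Lp_nested (ts ! k) (\<lambda>i. y (left_leaves ts k + i))" if "k < length ts" for k
    using that sum_list_take_add_less[OF that] by (intro Inner.IH Inner.prems) auto
  then show ?case by simp
qed simp

lemma Lp_nested_cong:
  "(\<And>i. i < nleaves t \<Longrightarrow> x i = y i) \<Longrightarrow> Lp_nested t x = Lp_nested t y"
  by (rule Lp_nested_cong_abs) simp

lemma Lp_nested_scale:
  "wf_tree t \<Longrightarrow> c \<ge> 0 \<Longrightarrow> Lp_nested t (\<lambda>i. c * x i) = c * Lp_nested t x"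
proof (induction t arbitrary: x)
  case (Inner p ts)
  have "Lp_nested (ts ! k) (\<lambda>i. c * x (left_leaves ts k + i)) =
        c * Lp_nested (ts ! k) (\<lambda>i. x (left_leaves ts k + i))" if "k < length ts" for k
    using that Inner.prems by (intro Inner.IH) auto
  then show ?case using Inner.prems
    by (simp add: powr_mult sum_distrib_left[symmetric] powr_powr)
qed (simp add: abs_mult)

section \<open>Concatenating and scaling vectors under Lebesgue measure\<close>

lemma borel_measurable_leb_component [measurable]:
  "i < n \<Longrightarrow> (\<lambda>x. x i) \<in> borel_measurable (leb n)"
  using measurable_component_singleton[of i "{..<n}" "\<lambda>_. lborel :: real measure"] by simp

text \<open>Restricting to \<open>{..<N + m}\<close> keeps the result in the space of
  \<open>leb (N + m)\<close>, whose points are \<open>undefined\<close> at all other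
  indices.\<close>

definition glue :: "nat \<Rightarrow> nat \<Rightarrow> (nat \<Rightarrow> real) \<Rightarrow> (nat \<Rightarrow> real) \<Rightarrow> nat \<Rightarrow> real" where
  "glue N m x y = (\<lambda>i\<in>{..<N + m}. if i < N then x i else y (i - N))"

lemma measurable_leb:
  assumes "\<And>i. i < n \<Longrightarrow> (\<lambda>x. f x i) \<in> borel_measurable M"
  shows "(\<lambda>x. \<lambda>i\<in>{..<n}. f x i) \<in> measurable M (leb n)"
  by (rule measurable_restrict) (use assms in auto)

lemma measurable_glue [measurable]:
  "case_prod (glue N m) \<in> measurable (leb N \<Otimes>\<^sub>M leb m) (leb (N + m))"
proof -
  have "(\<lambda>z. if i < N then fst z i else snd z (i - N)) \<in> borel_measurable (leb N \<Otimes>\<^sub>M leb m)"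
    if "i < N + m" for i
    using that measurable_compose[OF measurable_fst borel_measurable_leb_component[of i N]]
      measurable_compose[OF measurable_snd borel_measurable_leb_component[of "i - N" m]]
    by (cases "i < N") simp_all
  then show ?thesis
    unfolding glue_def case_prod_unfold by (rule measurable_leb)
qed

lemma nn_integral_leb_Suc:
  assumes "F \<in> borel_measurable (leb (Suc m))"
  shows "(\<integral>\<^sup>+x. F x \<partial>leb (Suc m)) = (\<integral>\<^sup>+x. (\<integral>\<^sup>+y. F (x(m := y)) \<partial>lborel) \<partial>leb m)"
proof -
  interpret product_sigma_finite "\<lambda>_::nat. lborel :: real measure" ..
  show ?thesis
    using product_nn_integral_insert[of "{..<m}" m F] assms by (simp add: lessThan_Suc)
qed

lemma measurable_leb_upd [measurable]:
  "(\<lambda>(x, y). x(m := y)) \<in> measurable (leb m \<Otimes>\<^sub>M lborel) (leb (Suc m))"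
  using measurable_add_dim[of m "{..<m}" "\<lambda>_. lborel :: real measure"]
  by (simp add: lessThan_Suc)

lemma sigma_finite_leb: "sigma_finite_measure (leb m)"
proof -
  interpret finite_product_sigma_finite "\<lambda>_::nat. lborel :: real measure" "{..<m}"
    by standard auto
  show ?thesis by (rule sigma_finite_measure_axioms)
qed

text \<open>Fubini for two blocks. The second block is indexed from 0 again, matching the
  coordinates of a child, so this is not literally a product over a disjoint union of index sets;
  the induction moves one coordinate at a time.\<close>

lemma nn_integral_leb_glue:
  assumes "F \<in> borel_measurable (leb (N + m))"
  shows "(\<integral>\<^sup>+x. F x \<partial>leb (N + m)) = (\<integral>\<^sup>+x. (\<integral>\<^sup>+y. F (glue N m x y) \<partial>leb m) \<partial>leb N)"
  using assms
proof (induction m arbitrary: F)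
  case 0
  interpret product_sigma_finite "\<lambda>_::nat. lborel :: real measure" ..
  have "glue N 0 x y = x" if "x \<in> space (leb N)" for x y
    using that by (auto simp: glue_def space_PiM PiE_def extensional_def fun_eq_iff)
  then show ?case
    unfolding add_0_right by (simp add: space_PiM_empty cong: nn_integral_cong)
next
  case (Suc m)
  have F: "F \<in> borel_measurable (leb (Suc (N + m)))" using Suc.prems by simp
  have upd: "(\<lambda>(x, y). F (x(N + m := y))) \<in> borel_measurable (leb (N + m) \<Otimes>\<^sub>M lborel)"
    using measurable_compose[OF measurable_leb_upd F] by (simp add: case_prod_unfold)
  have "(\<integral>\<^sup>+x. F x \<partial>leb (N + Suc m)) =
        (\<integral>\<^sup>+x. (\<integral>\<^sup>+z. F (x(N + m := z)) \<partial>lborel) \<partial>leb (N + m))"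
    using nn_integral_leb_Suc[OF F] by simp
  also have "\<dots> = (\<integral>\<^sup>+x. (\<integral>\<^sup>+y. (\<integral>\<^sup>+z. F ((glue N m x y)(N + m := z)) \<partial>lborel) \<partial>leb m) \<partial>leb N)"
    by (rule Suc.IH) (rule lborel.borel_measurable_nn_integral[OF upd])
  also have "\<dots> = (\<integral>\<^sup>+x. (\<integral>\<^sup>+y. F (glue N (Suc m) x y) \<partial>leb (Suc m)) \<partial>leb N)"
  proof (intro nn_integral_cong)
    fix x assume x: "x \<in> space (leb N)"
    have "(\<lambda>y. F (glue N (Suc m) x y)) \<in> borel_measurable (leb (Suc m))"
      using measurable_compose[OF measurable_compose[OF measurable_Pair1'[OF x] measurable_glue]
          Suc.prems] by simp
    then have "(\<integral>\<^sup>+y. F (glue N (Suc m) x y) \<partial>leb (Suc m)) =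
        (\<integral>\<^sup>+y. (\<integral>\<^sup>+z. F (glue N (Suc m) x (y(m := z))) \<partial>lborel) \<partial>leb m)"
      by (rule nn_integral_leb_Suc)
    moreover have "glue N (Suc m) x (y(m := z)) = (glue N m x y)(N + m := z)" for y z
      by (auto simp: glue_def fun_eq_iff)
    ultimately show "(\<integral>\<^sup>+y. (\<integral>\<^sup>+z. F ((glue N m x y)(N + m := z)) \<partial>lborel) \<partial>leb m) =
      (\<integral>\<^sup>+y. F (glue N (Suc m) x y) \<partial>leb (Suc m))" by simp
  qed
  finally show ?case .
qed

lemma nn_integral_leb_scale:
  assumes "F \<in> borel_measurable (leb m)" and r: "r > 0"
  shows "(\<integral>\<^sup>+x. F x \<partial>leb m) = ennreal (r ^ m) * (\<integral>\<^sup>+u. F (\<lambda>i\<in>{..<m}. r * u i) \<partial>leb m)"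
  using assms(1)
proof (induction m arbitrary: F)
  case 0
  interpret product_sigma_finite "\<lambda>_::nat. lborel :: real measure" ..
  show ?case by (simp add: nn_integral_empty space_PiM_empty restrict_def)
next
  case (Suc m)
  have upd: "(\<lambda>(x, y). F (x(m := y))) \<in> borel_measurable (leb m \<Otimes>\<^sub>M lborel)"
    using measurable_compose[OF measurable_leb_upd Suc.prems] unfolding case_prod_unfold .
  have scl: "(\<lambda>u. \<lambda>i\<in>{..<m}. r * u i) \<in> measurable (leb m) (leb m)" for m
    by (rule measurable_leb) measurable
  have upd': "(\<lambda>y. F (x(m := y))) \<in> borel_measurable borel" if "x \<in> space (leb m)" for x
    using measurable_compose[OF measurable_Pair1'[OF that] upd] by simp
  have inner: "(\<integral>\<^sup>+y. F (x(m := y)) \<partial>lborel) = ennreal r * (\<integral>\<^sup>+y. F (x(m := r * y)) \<partial>lborel)"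
    if "x \<in> space (leb m)" for x
    by (rule nn_integral_scale[OF upd'[OF that] r])
  have upd2: "(\<lambda>(x, y). F (x(m := r * y))) \<in> borel_measurable (leb m \<Otimes>\<^sub>M lborel)"
  proof -
    have "(\<lambda>(x, y). (x, r * y)) \<in> measurable (leb m \<Otimes>\<^sub>M lborel) (leb m \<Otimes>\<^sub>M lborel)"
      by measurable
    from measurable_compose[OF this upd] show ?thesis by (simp add: case_prod_unfold)
  qed
  have upd3: "(\<lambda>x. \<integral>\<^sup>+y. F (x(m := r * y)) \<partial>lborel) \<in> borel_measurable (leb m)"
    by (rule lborel.borel_measurable_nn_integral[OF upd2])
  have "(\<integral>\<^sup>+x. F x \<partial>leb (Suc m)) =
        (\<integral>\<^sup>+x. ennreal r * (\<integral>\<^sup>+y. F (x(m := r * y)) \<partial>lborel) \<partial>leb m)"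
    unfolding nn_integral_leb_Suc[OF Suc.prems] by (intro nn_integral_cong inner)
  also have "\<dots> = ennreal r * (\<integral>\<^sup>+x. (\<integral>\<^sup>+y. F (x(m := r * y)) \<partial>lborel) \<partial>leb m)"
    by (rule nn_integral_cmult[OF upd3])
  also have "(\<integral>\<^sup>+x. (\<integral>\<^sup>+y. F (x(m := r * y)) \<partial>lborel) \<partial>leb m) =
      ennreal (r ^ m) * (\<integral>\<^sup>+u. (\<integral>\<^sup>+y. F ((\<lambda>i\<in>{..<m}. r * u i)(m := r * y)) \<partial>lborel) \<partial>leb m)"
    by (rule Suc.IH[OF upd3])
  also have "(\<integral>\<^sup>+u. (\<integral>\<^sup>+y. F ((\<lambda>i\<in>{..<m}. r * u i)(m := r * y)) \<partial>lborel) \<partial>leb m) =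
      (\<integral>\<^sup>+u. F (\<lambda>i\<in>{..<Suc m}. r * u i) \<partial>leb (Suc m))"
  proof -
    have "(\<lambda>i\<in>{..<m}. r * u i)(m := r * y) = (\<lambda>i\<in>{..<Suc m}. r * (u(m := y)) i)" for u y
      by (auto simp: fun_eq_iff)
    then show ?thesis
      by (simp only: nn_integral_leb_Suc[OF measurable_compose[OF scl Suc.prems]])
  qed
  also have "ennreal r * (ennreal (r ^ m) * I) = ennreal (r ^ Suc m) * I" for I
    using r by (simp add: ennreal_mult' mult.assoc)
  finally show ?case .
qed

lemma nn_integral_lborel_even:
  fixes F :: "real \<Rightarrow> ennreal"
  assumes [measurable]: "F \<in> borel_measurable borel" and even: "\<And>y. F (- y) = F y"
  shows "(\<integral>\<^sup>+y. F y \<partial>lborel) = 2 * (\<integral>\<^sup>+y. F y * indicator {0<..} y \<partial>lborel)"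
proof -
  have "(\<integral>\<^sup>+y. F y \<partial>lborel) =
      (\<integral>\<^sup>+y. F y * indicator {0<..} y + F y * indicator {..<0} y \<partial>lborel)"
    \<comment> \<open>The two half-lines miss only the null set \<open>{0}\<close>.\<close>
    by (rule nn_integral_cong_AE)
       (use AE_lborel_singleton[of 0] in eventually_elim, auto simp: indicator_def)
  also have "\<dots> = (\<integral>\<^sup>+y. F y * indicator {0<..} y \<partial>lborel) + (\<integral>\<^sup>+y. F y * indicator {..<0} y \<partial>lborel)"
    by (rule nn_integral_add) auto
  also have "(\<integral>\<^sup>+y. F y * indicator {..<0} y \<partial>lborel) =
      (\<integral>\<^sup>+y. F (- y) * indicator {..<0} (- y) \<partial>lborel)"
    using nn_integral_real_affine[of "\<lambda>y. F y * indicator {..<0} y" "-1" 0] by simp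
  also have "\<dots> = (\<integral>\<^sup>+y. F y * indicator {0<..} y \<partial>lborel)"
    by (intro nn_integral_cong) (auto simp: even indicator_def)
  finally show ?thesis by (simp add: mult_2)
qed

subsection \<open>The law of the radius\<close>

text \<open>With n leaves this is n times the volume of the unit ball: take \<open>\<phi>\<close> in
  \<open>nn_integral_Lp_nested\<close> as the indicator of \<open>{..1}\<close>. A leaf gives 2 for
  the two signs of its coordinate. The first child of a node carries no Beta factor, every later one
  is combined with all children to its left.\<close>

fun radial_const :: "nested_tree \<Rightarrow> real" where
  "radial_const Leaf = 2"
| "radial_const (Inner p ts) = (\<Prod>k<length ts. radial_const (ts ! k)) *
     (\<Prod>k=1..length ts - 1. Beta ((\<Sum>i<k. real (nleaves (ts ! i))) / p)
        (real (nleaves (ts ! k)) / p) / p)"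

lemma radial_const_Inner_snoc:
  assumes "ts \<noteq> []"
  shows "radial_const (Inner p (ts @ [t])) = radial_const (Inner p ts) * radial_const t *
     (Beta (real (\<Sum>t\<leftarrow>ts. nleaves t) / p) (real (nleaves t) / p) / p)"
proof -
  let ?b = "\<lambda>us k. Beta ((\<Sum>i<k. real (nleaves (us ! i))) / p) (real (nleaves (us ! k)) / p) / p"
  have ex: "length ts = Suc (length ts - 1)" using assms by simp
  have "(\<Sum>i<length ts. real (nleaves (ts ! i))) = real (\<Sum>t\<leftarrow>ts. nleaves t)"
    by (simp add: sum_list_sum_nth atLeast0LessThan)
  then have b: "?b (ts @ [t]) (length ts) =
      Beta (real (\<Sum>t\<leftarrow>ts. nleaves t) / p) (real (nleaves t) / p) / p"
    by (simp add: nth_append)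
  have c: "(\<Prod>k<length ts. radial_const ((ts @ [t]) ! k)) = (\<Prod>k<length ts. radial_const (ts ! k))"
    by (intro prod.cong) (auto simp: nth_append)
  have d: "(\<Prod>k=1..length ts - 1. ?b (ts @ [t]) k) = (\<Prod>k=1..length ts - 1. ?b ts k)"
    by (intro prod.cong refl arg_cong2[of _ _ _ _ "\<lambda>x y. Beta (x / p) (y / p) / p"] sum.cong)
       (auto simp: nth_append)
  have set: "{1..length (ts @ [t]) - 1} = insert (length ts) {1..length ts - 1}"
    using ex by auto
  have "prod (?b (ts @ [t])) (insert (length ts) {1..length ts - 1}) =
        ?b (ts @ [t]) (length ts) * prod (?b (ts @ [t])) {1..length ts - 1}"
    by (rule prod.insert) (use ex in auto)
  then have "(\<Prod>k=1..length (ts @ [t]) - 1. ?b (ts @ [t]) k) =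
        (\<Prod>k=1..length ts - 1. ?b ts k) * ?b (ts @ [t]) (length ts)"
    by (simp only: set d mult.commute)
  moreover have "(\<Prod>k<length (ts @ [t]). radial_const ((ts @ [t]) ! k)) =
        (\<Prod>k<length ts. radial_const (ts ! k)) * radial_const t"
    using c by simp
  ultimately show ?thesis by (simp only: radial_const.simps b mult_ac)
qed

text \<open>Well-formedness is asked of the children and not of \<open>Inner p ts\<close>, because
  the induction over children passes through initial segments with a single child.\<close>

lemma radial_const_Inner_pos:
  assumes p: "p > 0" and ts: "\<And>t. t \<in> set ts \<Longrightarrow> wf_tree t \<and> radial_const t > 0"
  shows "radial_const (Inner p ts) > 0"
proof -
  have n: "nleaves (ts ! k) > 0" if "k < length ts" for k
    using nleaves_pos[of "ts ! k"] ts[of "ts ! k"] that by (simp add: Suc_le_eq)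
  have b: "Beta ((\<Sum>i<k. real (nleaves (ts ! i))) / p) (real (nleaves (ts ! k)) / p) > 0"
    if "k \<in> {1..length ts - 1}" for k
  proof -
    have "(\<Sum>i<k. real (nleaves (ts ! i))) > 0"
      using that n by (intro sum_pos) (auto simp: lessThan_empty_iff)
    moreover have "k < length ts" using that by auto
    ultimately show ?thesis using n[of k] p
      by (auto simp: Beta_def intro!: divide_pos_pos mult_pos_pos Gamma_real_pos add_pos_pos)
  qed
  show ?thesis
    using p ts b by (auto intro!: mult_pos_pos prod_pos divide_pos_pos)
qed

lemma radial_const_pos: "wf_tree t \<Longrightarrow> radial_const t > 0"
proof (induction t)
  case (Inner p ts)
  then show ?case by (intro radial_const_Inner_pos) auto
qed simp

text \<open>The statement quantifies over all \<open>\<phi>\<close> because the induction changes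
  it: with the earlier children fixed at norm \<open>a\<close>, the last child is integrated against
  \<open>s \<mapsto> \<phi> ((a powr p + s powr p) powr (1/p))\<close>. The result depends only on
  \<open>a\<close>, so it is again a radial integrand for the earlier children.\<close>

lemma nn_integral_Lp_nested:
  assumes "wf_tree t" and "\<phi> \<in> borel_measurable borel"
  shows "(\<integral>\<^sup>+x. \<phi> (Lp_nested t x) \<partial>leb (nleaves t)) = ennreal (radial_const t) *
     (\<integral>\<^sup>+r. \<phi> r * ennreal (r powr (real (nleaves t) - 1)) * indicator {0<..} r \<partial>lborel)"
  using assms
proof (induction t arbitrary: \<phi>)
  case Leaf
  interpret product_sigma_finite "\<lambda>_::nat. lborel :: real measure" ..
  have [measurable]: "\<phi> \<in> borel_measurable borel" by (rule Leaf)
  have "{..<1::nat} = {0}" by auto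
  then have "(\<integral>\<^sup>+x. \<phi> (Lp_nested Leaf x) \<partial>leb (nleaves Leaf)) = (\<integral>\<^sup>+y. \<phi> \<bar>y\<bar> \<partial>lborel)"
    using product_nn_integral_singleton[of "\<lambda>y. \<phi> \<bar>y\<bar>" 0] by simp
  also have "\<dots> = 2 * (\<integral>\<^sup>+y. \<phi> \<bar>y\<bar> * indicator {0<..} y \<partial>lborel)"
    by (rule nn_integral_lborel_even) auto
  also have "(\<integral>\<^sup>+y. \<phi> \<bar>y\<bar> * indicator {0<..} y \<partial>lborel) =
      (\<integral>\<^sup>+r. \<phi> r * ennreal (r powr (real (nleaves Leaf) - 1)) * indicator {0<..} r \<partial>lborel)"
    by (intro nn_integral_cong) (auto simp: indicator_def)
  finally show ?case by simp
next
  case (Inner p ts)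
  have p: "p > 0" using Inner.prems by simp
  let ?S = "\<lambda>us x. (\<Sum>k<length us. Lp_nested (us ! k) (\<lambda>i. x (left_leaves us k + i)) powr p) powr (1 / p)"
  \<comment> \<open>Inner induction over nonempty lists of children, extended on the right. It
    speaks of \<open>?S us\<close> because such a list need not form a well-formed node.\<close>
  have "(\<integral>\<^sup>+x. \<phi> (?S us x) \<partial>leb (\<Sum>t\<leftarrow>us. nleaves t)) = ennreal (radial_const (Inner p us)) *
     (\<integral>\<^sup>+r. \<phi> r * ennreal (r powr (real (\<Sum>t\<leftarrow>us. nleaves t) - 1)) * indicator {0<..} r \<partial>lborel)"
    if "us \<noteq> []" "set us \<subseteq> set ts" "\<phi> \<in> borel_measurable borel" for us \<phi>
    using that
  proof (induction us arbitrary: \<phi> rule: rev_nonempty_induct)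
    case (single t)
    have "wf_tree t" using single Inner.prems by auto
    then show ?case
      using Inner.IH[of t \<phi>] single p by (simp add: powr_powr Lp_nested_nonneg)
  next
    case (snoc t us)
    define N where "N = (\<Sum>t\<leftarrow>us. nleaves t)"
    define m where "m = nleaves t"
    have [measurable]: "\<phi> \<in> borel_measurable borel" by (rule snoc)
    have wf: "wf_tree u" if "u \<in> set (us @ [t])" for u using that snoc.prems Inner.prems by auto
    have m: "m > 0" using nleaves_pos[OF wf[of t]] by (simp add: m_def)
    obtain u us' where us: "us = u # us'" using snoc.hyps by (cases us) auto
    have N: "N > 0" using nleaves_pos[OF wf[of u]] by (simp add: N_def us)
    \<comment> \<open>Up to the factor \<open>radial_const t\<close>, this is the integral over the
      new child when the earlier children have norm \<open>a\<close>. Integrating it against the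
      radial law of the earlier children is the situation of
      \<open>nn_integral_Lp_combine\<close>.\<close>
    define \<Psi> where "\<Psi> a = (\<integral>\<^sup>+b. \<phi> ((a powr p + b powr p) powr (1/p)) *
        ennreal (b powr (real m - 1)) * indicator {0<..} b \<partial>lborel)" for a
    have \<Psi> [measurable]: "\<Psi> \<in> borel_measurable borel"
      unfolding \<Psi>_def by measurable
    have S_glue: "?S (us @ [t]) (glue N m x y) =
        (?S us x powr p + Lp_nested t y powr p) powr (1 / p)" for x y
    proof -
      have "Lp_nested ((us @ [t]) ! k) (\<lambda>i. glue N m x y (left_leaves (us @ [t]) k + i)) =
            Lp_nested (us ! k) (\<lambda>i. x (left_leaves us k + i))" if "k < length us" for k
      proof -
        have "Lp_nested (us ! k) (\<lambda>i. glue N m x y (left_leaves us k + i)) =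
              Lp_nested (us ! k) (\<lambda>i. x (left_leaves us k + i))"
          using sum_list_take_add_less[OF that]
          by (intro Lp_nested_cong) (auto simp: glue_def N_def trans_less_add1)
        then show ?thesis using that by (simp add: nth_append)
      qed
      moreover have "Lp_nested t (\<lambda>i. glue N m x y (N + i)) = Lp_nested t y"
        by (intro Lp_nested_cong) (auto simp: glue_def m_def)
      ultimately show ?thesis using p
        by (simp add: N_def powr_powr sum_nonneg)
    qed
    have meas: "(\<lambda>x. \<phi> (?S (us @ [t]) x)) \<in> borel_measurable (leb (N + m))"
      using measurable_compose[OF Lp_nested_measurable[of "Inner p (us @ [t])"], of \<phi> borel]
      by (simp add: N_def m_def)
    have inner: "(\<integral>\<^sup>+y. \<phi> (?S (us @ [t]) (glue N m x y)) \<partial>leb m) =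
        ennreal (radial_const t) * \<Psi> (?S us x)" for x
    proof -
      have "(\<lambda>s. \<phi> ((?S us x powr p + s powr p) powr (1 / p))) \<in> borel_measurable borel"
        by measurable
      moreover have "t \<in> set ts" using snoc.prems by simp
      ultimately show ?thesis
        using Inner.IH[of t "\<lambda>s. \<phi> ((?S us x powr p + s powr p) powr (1 / p))"] wf[of t]
        unfolding S_glue unfolding m_def \<Psi>_def by simp
    qed
    have Smeas: "(\<lambda>x. \<Psi> (?S us x)) \<in> borel_measurable (leb N)"
      using measurable_compose[OF Lp_nested_measurable[of "Inner p us"], of \<Psi> borel]
      by (simp add: N_def)
    have comb: "(\<integral>\<^sup>+r. \<Psi> r * ennreal (r powr (real N - 1)) * indicator {0<..} r \<partial>lborel) =
       ennreal (Beta (real N/p) (real m/p) / p) *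
       (\<integral>\<^sup>+r. \<phi> r * ennreal (r powr (real (N + m) - 1)) * indicator {0<..} r \<partial>lborel)"
      using nn_integral_Lp_combine[of \<phi> p "real N" "real m"] p N m unfolding \<Psi>_def by simp
    have IH: "(\<integral>\<^sup>+x. \<Psi> (?S us x) \<partial>leb N) = ennreal (radial_const (Inner p us)) *
     (\<integral>\<^sup>+r. \<Psi> r * ennreal (r powr (real N - 1)) * indicator {0<..} r \<partial>lborel)"
      using snoc.IH[of \<Psi>] snoc.prems unfolding N_def by simp
    have Nm: "(\<Sum>t\<leftarrow>us @ [t]. nleaves t) = N + m" by (simp add: N_def m_def)
    have c: "radial_const (Inner p us) > 0"
      by (rule radial_const_Inner_pos[OF p]) (use wf radial_const_pos in auto)
    have c': "radial_const t > 0"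
      by (rule radial_const_pos) (use wf in simp)
    have rc: "ennreal (radial_const (Inner p (us @ [t]))) = ennreal (radial_const t) *
       (ennreal (radial_const (Inner p us)) * ennreal (Beta (real N/p) (real m/p) / p))"
    proof -
      have "ennreal (a * b * d) = ennreal b * (ennreal a * ennreal d)" if "a > 0" "b > 0" for a b d
        using that by (simp add: ennreal_mult' mult_ac)
      from this[OF c c'] show ?thesis
        unfolding radial_const_Inner_snoc[OF snoc.hyps(1)] N_def m_def .
    qed
    show ?case
      unfolding Nm nn_integral_leb_glue[OF meas] inner nn_integral_cmult[OF Smeas] IH comb rc
      by (simp only: mult.assoc)
  qed
  moreover have "ts \<noteq> []" using Inner.prems by auto
  ultimately show ?case using Inner.prems(2) by simp
qed

subsection \<open>The Jacobian in the last coordinate\<close>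

text \<open>The paper's \<open>g\<close> at the last child of an inner node where \<open>g\<close> has the value \<open>r\<close>.\<close>

definition last_radius :: "real \<Rightarrow> nested_tree list \<Rightarrow> real \<Rightarrow> (nat \<Rightarrow> real) \<Rightarrow> real" where
  "last_radius p ts r u = (r powr p -
     (\<Sum>j<length ts - 1. Lp_nested (ts ! j) (\<lambda>i. u (left_leaves ts j + i)) powr p)) powr (1 / p)"

text \<open>The product of the factors G along the path to the last leaf, for root value
  \<open>r\<close> (\<open>prod_path_radius\<close>). Keeping \<open>r\<close> as an argument lets
  the recursion restart at the last child with that child's own radius.\<close>

fun path_jacobian :: "nested_tree \<Rightarrow> real \<Rightarrow> (nat \<Rightarrow> real) \<Rightarrow> real" where
  "path_jacobian Leaf r u = 1"
| "path_jacobian (Inner p ts) r u =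
     (if ts = [] then 1
      else last_radius p ts r u powr (exponent (ts ! (length ts - 1)) - p) *
        path_jacobian (ts ! (length ts - 1)) (last_radius p ts r u)
          (\<lambda>i. u (left_leaves ts (length ts - 1) + i)))"

lemma path_jacobian_nonneg: "path_jacobian t r u \<ge> 0"
  by (induction t r u rule: path_jacobian.induct) auto

lemma left_leaves_last:
  "ts \<noteq> [] \<Longrightarrow> (\<Sum>t\<leftarrow>ts. nleaves t) =
     left_leaves ts (length ts - 1) + nleaves (ts ! (length ts - 1))"
  using id_take_nth_drop[of "length ts - 1" ts] 
  by (cases ts rule: rev_cases) auto

lemma left_leaves_add_less_last:
  assumes wf: "wf_tree (Inner p ts)" and k: "k < length ts - 1" and i: "i < nleaves (ts ! k)"
  shows "left_leaves ts k + i < left_leaves ts (length ts - 1)"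
proof -
  have "left_leaves ts k + i = left_leaves (take (length ts - 1) ts) k + i"
    using k by (simp add: min_def)
  also have "\<dots> < left_leaves ts (length ts - 1)"
    using k i sum_list_take_add_less[of k "take (length ts - 1) ts" i] by simp
  finally show ?thesis .
qed

lemma last_child:
  assumes "wf_tree (Inner p ts)"
  shows "ts \<noteq> []" "wf_tree (ts ! (length ts - 1))" "ts ! (length ts - 1) \<in> set ts" "p > 0"
  using assms by (auto simp: wf_tree.simps(2))

lemma last_radius_cong:
  assumes "wf_tree (Inner p ts)" and "\<And>i. i < left_leaves ts (length ts - 1) \<Longrightarrow> u i = v i"
  shows "last_radius p ts r u = last_radius p ts r v"
proof -
  have "Lp_nested (ts ! j) (\<lambda>i. u (left_leaves ts j + i)) =
        Lp_nested (ts ! j) (\<lambda>i. v (left_leaves ts j + i))" if "j < length ts - 1" for j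
    using left_leaves_add_less_last[OF assms(1) that] assms(2) by (intro Lp_nested_cong) auto
  then show ?thesis by (simp add: last_radius_def)
qed

text \<open>Only left siblings of the path enter, and at every level the last coordinate lies in the
  last child.\<close>

lemma path_jacobian_cong:
  assumes "wf_tree t" and "\<And>i. i < nleaves t - 1 \<Longrightarrow> u i = v i"
  shows "path_jacobian t r u = path_jacobian t r v"
  using assms
proof (induction t arbitrary: r u v)
  case (Inner p ts)
  note lc = last_child[OF Inner.prems(1)]
  let ?c = "ts ! (length ts - 1)"
  have N: "nleaves (Inner p ts) - 1 = left_leaves ts (length ts - 1) + (nleaves ?c - 1)"
    using left_leaves_last[OF lc(1)] nleaves_pos[OF lc(2)] by simp
  have rad: "last_radius p ts r u = last_radius p ts r v"
    by (rule last_radius_cong[OF Inner.prems(1)]) (use Inner.prems(2) N in auto)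
  have "path_jacobian ?c s (\<lambda>i. u (left_leaves ts (length ts - 1) + i)) =
        path_jacobian ?c s (\<lambda>i. v (left_leaves ts (length ts - 1) + i))" for s
    by (rule Inner.IH[OF lc(3,2)]) (rule Inner.prems(2), use N in linarith)
  then show ?case by (simp add: rad)
qed simp

lemma measurable_last_radius:
  assumes wf: "wf_tree (Inner p ts)" and [measurable]: "R \<in> borel_measurable M"
    and X: "\<And>i. i < left_leaves ts (length ts - 1) \<Longrightarrow> (\<lambda>w. X w i) \<in> borel_measurable M"
  shows "(\<lambda>w. last_radius p ts (R w) (X w)) \<in> borel_measurable M"
proof -
  have L: "(\<lambda>w. Lp_nested (ts ! j) (\<lambda>i. X w (left_leaves ts j + i))) \<in> borel_measurable M"
    if "j < length ts - 1" for j
    using left_leaves_add_less_last[OF wf that] by (intro Lp_nested_measurable_aux X)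
  have "(\<lambda>w. Lp_nested (ts ! j) (\<lambda>i. X w (left_leaves ts j + i)) powr p) \<in> borel_measurable M"
    if "j < length ts - 1" for j
    using measurable_compose[OF L[OF that], of "\<lambda>x. x powr p" borel] by simp
  then have "(\<lambda>w. \<Sum>j<length ts - 1. Lp_nested (ts ! j) (\<lambda>i. X w (left_leaves ts j + i)) powr p)
      \<in> borel_measurable M"
    by (intro borel_measurable_sum) auto
  then show ?thesis
    unfolding last_radius_def by measurable
qed

text \<open>Radius and vector both depend on a common parameter, which gives measurability in the
  radius, in the vector, and jointly for the exchange of integrals.\<close>

lemma measurable_path_jacobian:
  assumes "wf_tree t" and "R \<in> borel_measurable M"
    and "\<And>i. i < nleaves t - 1 \<Longrightarrow> (\<lambda>w. X w i) \<in> borel_measurable M"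
  shows "(\<lambda>w. path_jacobian t (R w) (X w)) \<in> borel_measurable M"
  using assms
proof (induction t arbitrary: R X)
  case (Inner p ts)
  note lc = last_child[OF Inner.prems(1)]
  let ?c = "ts ! (length ts - 1)"
  have N: "nleaves (Inner p ts) - 1 = left_leaves ts (length ts - 1) + (nleaves ?c - 1)"
    using left_leaves_last[OF lc(1)] nleaves_pos[OF lc(2)] by simp
  have rad [measurable]: "(\<lambda>w. last_radius p ts (R w) (X w)) \<in> borel_measurable M"
    by (rule measurable_last_radius[OF Inner.prems(1,2)]) (rule Inner.prems(3), use N in linarith)
  have [measurable]: "(\<lambda>w. path_jacobian ?c (last_radius p ts (R w) (X w))
      (\<lambda>i. X w (left_leaves ts (length ts - 1) + i))) \<in> borel_measurable M"
    by (rule Inner.IH[OF lc(3,2) rad]) (rule Inner.prems(3), use N in linarith)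
  have "(\<lambda>w. last_radius p ts (R w) (X w) powr (exponent ?c - p) * path_jacobian ?c
      (last_radius p ts (R w) (X w)) (\<lambda>i. X w (left_leaves ts (length ts - 1) + i)))
      \<in> borel_measurable M"
    by measurable
  then show ?case using lc(1) by simp
qed simp

lemma last_radius_scale:
  assumes "wf_tree (Inner p ts)" "c > 0"
  shows "last_radius p ts (c * r) (\<lambda>i. c * u i) = c * last_radius p ts r u"
proof -
  note lc = last_child[OF assms(1)]
  have "Lp_nested (ts ! j) (\<lambda>i. c * u (left_leaves ts j + i)) powr p =
        c powr p * Lp_nested (ts ! j) (\<lambda>i. u (left_leaves ts j + i)) powr p"
    if "j < length ts - 1" for j
    using that assms by (subst Lp_nested_scale) (auto simp: powr_mult)
  then have "(c * r) powr p - (\<Sum>j<length ts - 1. Lp_nested (ts ! j)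
       (\<lambda>i. c * u (left_leaves ts j + i)) powr p) =
     c powr p * (r powr p - (\<Sum>j<length ts - 1. Lp_nested (ts ! j)
       (\<lambda>i. u (left_leaves ts j + i)) powr p))"
    by (simp add: powr_mult sum_distrib_left right_diff_distrib)
  then show ?thesis
    using assms(2) lc(4) unfolding last_radius_def by (simp add: powr_mult powr_powr)
qed

text \<open>The degrees telescope: \<open>exponent ?c - p\<close> from the factor of the last child
  and \<open>1 - exponent ?c\<close> from the path below it add up to \<open>1 - p\<close>. A leaf
  has degree 0.\<close>

lemma path_jacobian_scale:
  assumes "wf_tree t" "c > 0"
  shows "path_jacobian t (c * r) (\<lambda>i. c * u i) = c powr (1 - exponent t) * path_jacobian t r u"
  using assms
proof (induction t arbitrary: r u)
  case (Inner p ts)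
  note lc = last_child[OF Inner.prems(1)]
  let ?c = "ts ! (length ts - 1)"
  let ?J = "path_jacobian ?c (last_radius p ts r u) (\<lambda>i. u (left_leaves ts (length ts - 1) + i))"
  have "path_jacobian (Inner p ts) (c * r) (\<lambda>i. c * u i) =
      (c * last_radius p ts r u) powr (exponent ?c - p) * (c powr (1 - exponent ?c) * ?J)"
    using lc(1) by (simp only: path_jacobian.simps last_radius_scale[OF Inner.prems]
        Inner.IH[OF lc(3,2) Inner.prems(2)] if_False)
  also have "\<dots> = c powr (exponent ?c - p) * c powr (1 - exponent ?c) *
      (last_radius p ts r u powr (exponent ?c - p) * ?J)"
    by (simp only: powr_mult mult_ac)
  also have "c powr (exponent ?c - p) * c powr (1 - exponent ?c) = c powr (1 - p)"
    by (simp add: powr_add[symmetric])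
  finally show ?case using lc(1) by simp
qed simp

lemma path_jacobian_homogeneous:
  assumes "wf_tree t" "r > 0"
  shows "r powr (exponent t - 1) * path_jacobian t r (\<lambda>i. r * u i) = path_jacobian t 1 u"
proof -
  have "r powr (exponent t - 1) * r powr (1 - exponent t) = 1"
    using assms(2) by (simp add: powr_add[symmetric])
  then show ?thesis
    using path_jacobian_scale[OF assms, of 1 u] by (simp add: mult.assoc[symmetric])
qed

text \<open>On \<open>y > 0\<close> the map from the last coordinate to the norm is increasing,
  starting from the norm at \<open>y = 0\<close>, which becomes the lower limit for
  \<open>r\<close>. Arbitrary \<open>\<psi>\<close> allows the induction to absorb the outer levels
  into the integrand.\<close>

lemma nn_integral_last_coordinate:
  assumes "wf_tree t" and "\<psi> \<in> borel_measurable borel"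
  shows "(\<integral>\<^sup>+y. \<psi> (Lp_nested t (x(nleaves t - 1 := y))) * indicator {0<..} y \<partial>lborel) =
    (\<integral>\<^sup>+r. \<psi> r * ennreal (r powr (exponent t - 1) * path_jacobian t r x) *
       indicator {Lp_nested t (x(nleaves t - 1 := 0))<..} r \<partial>lborel)"
  using assms
proof (induction t arbitrary: \<psi> x)
  case Leaf
  show ?case by (intro nn_integral_cong) (auto simp: indicator_def)
next
  case (Inner p ts)
  note lc = last_child[OF Inner.prems(1)]
  have [measurable]: "\<psi> \<in> borel_measurable borel" by (rule Inner.prems)
  define l where "l = length ts - 1"
  define c where "c = ts ! l"
  define off where "off = left_leaves ts l"
  define x' where "x' i = x (off + i)" for i
  define A where "A = (\<Sum>j<l. Lp_nested (ts ! j) (\<lambda>i. x (left_leaves ts j + i)) powr p)"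
  define b where "b = Lp_nested c (x'(nleaves c - 1 := 0))"
  have c: "wf_tree c" "c \<in> set ts" and p: "p > 0" using lc by (simp_all add: c_def l_def)
  have N: "nleaves (Inner p ts) - 1 = off + (nleaves c - 1)"
    using left_leaves_last[OF lc(1)] nleaves_pos[OF lc(2)] by (simp add: c_def l_def off_def)
  have len: "length ts = Suc l" using lc(1) by (simp add: l_def)
  have f: "Lp_nested (Inner p ts) (x(nleaves (Inner p ts) - 1 := y)) =
      (A + Lp_nested c (x'(nleaves c - 1 := y)) powr p) powr (1 / p)" for y
  proof -
    have "Lp_nested (ts ! k) (\<lambda>i. (x(off + (nleaves c - 1) := y)) (left_leaves ts k + i)) =
          Lp_nested (ts ! k) (\<lambda>i. x (left_leaves ts k + i))" if "k < l" for k
    proof (rule Lp_nested_cong)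
      fix i assume "i < nleaves (ts ! k)"
      then have "left_leaves ts k + i < off"
        using left_leaves_add_less_last[OF Inner.prems(1)] that by (simp add: off_def l_def)
      then show "(x(off + (nleaves c - 1) := y)) (left_leaves ts k + i) = x (left_leaves ts k + i)"
        by simp
    qed
    then have sum: "(\<Sum>k<l. Lp_nested (ts ! k)
        (\<lambda>i. (x(off + (nleaves c - 1) := y)) (left_leaves ts k + i)) powr p) = A"
      unfolding A_def by (intro sum.cong) auto
    have "(\<lambda>i. (x(off + (nleaves c - 1) := y)) (off + i)) = x'(nleaves c - 1 := y)"
      by (auto simp: x'_def)
    then show ?thesis
      unfolding N Lp_nested.simps len sum.lessThan_Suc sum off_def[symmetric] c_def[symmetric]
      by (rule arg_cong)
  qed
  have A: "A \<ge> 0" by (auto simp: A_def intro: sum_nonneg)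
  have b: "b \<ge> 0" by (simp add: b_def Lp_nested_nonneg)
  define g where "g r = (r powr p - A) powr (1 / p)" for r
  have g: "last_radius p ts r x = g r" for r
    by (simp add: last_radius_def g_def A_def l_def)
  have [measurable]: "(\<lambda>s. path_jacobian c s x') \<in> borel_measurable borel"
    by (rule measurable_path_jacobian[OF c(1)]) auto
  \<comment> \<open>The last child is handled with \<open>\<psi>\<close> replaced by
    \<open>s \<mapsto> \<psi> ((A + s powr p) powr (1 / p))\<close>; only the passage from its
    radius \<open>s\<close> to \<open>r\<close> remains.\<close>
  have "(\<integral>\<^sup>+y. \<psi> (Lp_nested (Inner p ts) (x(nleaves (Inner p ts) - 1 := y))) *
          indicator {0<..} y \<partial>lborel) =
        (\<integral>\<^sup>+s. \<psi> ((A + s powr p) powr (1 / p)) *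
          ennreal (s powr (exponent c - 1) * path_jacobian c s x') * indicator {b<..} s \<partial>lborel)"
    unfolding f b_def by (rule Inner.IH[OF c(2,1)]) measurable
  also have "\<dots> = (\<integral>\<^sup>+r. \<psi> ((A + g r powr p) powr (1 / p)) *
          ennreal (g r powr (exponent c - 1) * path_jacobian c (g r) x') *
          ennreal ((r powr p - A) powr ((1 - p)/p) * r powr (p - 1)) *
          indicator {(A + b powr p) powr (1/p)<..} r \<partial>lborel)"
    unfolding g_def by (rule nn_integral_substitution_powr_diff[OF _ p A b]) measurable
  also have "\<dots> = (\<integral>\<^sup>+r. \<psi> r * ennreal (r powr (exponent (Inner p ts) - 1) *
          path_jacobian (Inner p ts) r x) *
       indicator {Lp_nested (Inner p ts) (x(nleaves (Inner p ts) - 1 := 0))<..} r \<partial>lborel)"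
  proof (intro nn_integral_cong)
    fix r :: real
    have f0: "Lp_nested (Inner p ts) (x(nleaves (Inner p ts) - 1 := 0)) =
        (A + b powr p) powr (1 / p)"
      unfolding f b_def ..
    have J: "path_jacobian (Inner p ts) r x = g r powr (exponent c - p) * path_jacobian c (g r) x'"
      using lc(1) by (simp add: g c_def l_def x'_def[abs_def] off_def)
    show "\<psi> ((A + g r powr p) powr (1 / p)) *
          ennreal (g r powr (exponent c - 1) * path_jacobian c (g r) x') *
          ennreal ((r powr p - A) powr ((1 - p)/p) * r powr (p - 1)) *
          indicator {(A + b powr p) powr (1/p)<..} r =
        \<psi> r * ennreal (r powr (exponent (Inner p ts) - 1) * path_jacobian (Inner p ts) r x) *
          indicator {Lp_nested (Inner p ts) (x(nleaves (Inner p ts) - 1 := 0))<..} r"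
    proof (cases "(A + b powr p) powr (1/p) < r")
      case True
      have "r > 0" using True powr_ge_zero[of "A + b powr p" "1/p"] by linarith
      have "((A + b powr p) powr (1/p)) powr p < r powr p"
        using True p by (intro powr_less_mono2) auto
      then have "A + b powr p < r powr p" using p A by (simp add: powr_powr)
      then have "r powr p - A > 0"
        using powr_ge_zero[of b p] by linarith
      then have gp: "g r powr p = r powr p - A"
        using p by (simp add: g_def powr_powr)
      have 1: "(A + g r powr p) powr (1 / p) = r"
        using p \<open>r > 0\<close> by (simp add: gp powr_powr)
      have "(r powr p - A) powr ((1 - p)/p) = g r powr (1 - p)"
        by (simp add: g_def powr_powr)
      moreover have "g r powr (exponent c - p) = g r powr (exponent c - 1) * g r powr (1 - p)"
        by (simp add: powr_add[symmetric])
      ultimately have 2: "ennreal (g r powr (exponent c - 1) * path_jacobian c (g r) x') *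
          ennreal ((r powr p - A) powr ((1 - p)/p) * r powr (p - 1)) =
          ennreal (r powr (exponent (Inner p ts) - 1) * path_jacobian (Inner p ts) r x)"
        unfolding J by (subst ennreal_mult[symmetric])
          (simp_all add: path_jacobian_nonneg mult_ac)
      show ?thesis unfolding 1 f0 mult.assoc by (simp only: 2 mult.assoc[symmetric])
    next
      case False
      then have "indicator {(A + b powr p) powr (1/p)<..} r = (0 :: ennreal)" by simp
      then show ?thesis by (simp only: f0 mult_zero_right)
    qed
  qed
  finally show ?case .
qed

subsection \<open>The density as a Jacobian\<close>

text \<open>The paper's \<open>g\<close> with \<open>r\<close> instead of 1 at the root.\<close>

fun path_radius :: "nested_tree \<Rightarrow> real \<Rightarrow> nat list \<Rightarrow> (nat \<Rightarrow> real) \<Rightarrow> real" where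
  "path_radius t r [] u = r"
| "path_radius Leaf r (k # I) u = r"
| "path_radius (Inner p ts) r (k # I) u =
     path_radius (ts ! k) (last_radius p ts r u) I (\<lambda>i. u (left_leaves ts k + i))"

text \<open>\<open>path_radius\<close> consumes a multi-index from the root, \<open>node_g\<close>
  from its end. This gives the former the recursion of the latter.\<close>

lemma path_radius_snoc:
  assumes "J @ [j] \<in> nodes t"
  shows "path_radius t r (J @ [j]) u =
    (path_radius t r J u powr node_p t J -
      (\<Sum>i<node_l t J - 1. node_f t (J @ [i]) u powr node_p t J)) powr (1 / node_p t J)"
  using assms
proof (induction J arbitrary: t r u)
  case Nil
  then obtain p ts where "t = Inner p ts" by (cases t) auto
  then show ?case
    by (simp add: last_radius_def node_p_def node_l_def node_f_def)
next
  case (Cons k J)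
  then obtain p ts where t: "t = Inner p ts" and k: "J @ [j] \<in> nodes (ts ! k)"
    by (cases t) auto
  have "node_f (ts ! k) (J @ [i]) (\<lambda>i. u (left_leaves ts k + i)) = node_f t (k # J @ [i]) u" for i
    by (simp add: node_f_def t add.assoc)
  then show ?case
    using Cons.IH[OF k, of "last_radius p ts r u" "\<lambda>i. u (left_leaves ts k + i)"]
    by (simp add: t node_p_def node_l_def)
qed

lemma nodes_prefix: "I @ J \<in> nodes t \<Longrightarrow> I \<in> nodes t"
proof (induction I arbitrary: t)
  case Nil
  then show ?case by (cases t) auto
next
  case (Cons k I)
  then show ?case by (cases t) auto
qed

lemma node_g_eq_path_radius: "I \<in> nodes t \<Longrightarrow> node_g t I u = path_radius t 1 I u"
proof (induction I rule: rev_induct)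
  case Nil
  show ?case by (simp add: node_g.simps)
next
  case (snoc j J)
  then have "node_g t J u = path_radius t 1 J u"
    using nodes_prefix by blast
  then show ?case
    unfolding path_radius_snoc[OF snoc.prems]
    by (subst node_g.simps) (simp add: Let_def)
qed

lemma last_leaf_in_nodes: "wf_tree t \<Longrightarrow> last_leaf t \<in> nodes t"
proof (induction t)
  case (Inner p ts)
  note lc = last_child[OF Inner.prems]
  have "last_leaf (ts ! (length ts - 1)) \<in> nodes (ts ! (length ts - 1))"
    by (rule Inner.IH[OF lc(3,2)])
  moreover have "length ts - 1 < length ts" using lc(1) by (simp add: Suc_le_eq)
  ultimately show ?case using lc(1) by auto
qed simp

lemma last_path_subset_nodes:
  assumes "wf_tree t"
  shows "last_path t \<subseteq> nodes t"
proof
  fix L assume "L \<in> last_path t"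
  then obtain L' where "last_leaf t = L @ L'" by (auto simp: last_path_def prefix_def)
  then show "L \<in> nodes t" using last_leaf_in_nodes[OF assms] nodes_prefix[of L L' t] by simp
qed

lemma last_path_Inner:
  assumes "ts \<noteq> []"
  shows "last_path (Inner p ts) =
     insert [length ts - 1] ((#) (length ts - 1) ` last_path (ts ! (length ts - 1)))"
proof (intro equalityI subsetI)
  fix L assume "L \<in> last_path (Inner p ts)"
  then obtain L' where "L = (length ts - 1) # L'" "prefix L' (last_leaf (ts ! (length ts - 1)))"
    using assms by (cases L) (auto simp: last_path_def)
  then show "L \<in> insert [length ts - 1] ((#) (length ts - 1) ` last_path (ts ! (length ts - 1)))"
    by (auto simp: last_path_def)
qed (use assms in \<open>auto simp: last_path_def\<close>)

lemma finite_last_path: "finite (last_path t)"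
proof (rule finite_subset)
  show "last_path t \<subseteq> set (prefixes (last_leaf t))" by (auto simp: last_path_def)
qed simp

lemma prod_path_radius:
  assumes "wf_tree t"
  shows "(\<Prod>L\<in>last_path t. path_radius t r L u powr (node_p t L - node_p t (butlast L))) =
         path_jacobian t r u"
  using assms
proof (induction t arbitrary: r u)
  case Leaf
  have "last_path Leaf = {}" by (auto simp: last_path_def)
  then show ?case by simp
next
  case (Inner p ts)
  note lc = last_child[OF Inner.prems]
  define l where "l = length ts - 1"
  let ?t = "Inner p ts" and ?c = "ts ! l" and ?s = "last_radius p ts r u"
    and ?v = "\<lambda>i. u (left_leaves ts l + i)"
  let ?F = "\<lambda>L. path_radius ?t r L u powr (node_p ?t L - node_p ?t (butlast L))"
  \<comment> \<open>Members of \<open>last_path\<close> are nonempty, so \<open>butlast\<close>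
    commutes with prepending \<open>l\<close>; the node \<open>[l]\<close> itself is split off
    separately.\<close>
  have child: "?F (l # L) =
      path_radius ?c ?s L ?v powr (node_p ?c L - node_p ?c (butlast L))" if "L \<in> last_path ?c" for L
    using that by (cases L) (auto simp: last_path_def node_p_def)
  have "prod ?F (last_path ?t) = ?F [l] * prod ?F ((#) l ` last_path ?c)"
    unfolding last_path_Inner[OF lc(1)] l_def[symmetric]
    by (rule prod.insert) (intro finite_imageI finite_last_path, auto simp: last_path_def)
  also have "prod ?F ((#) l ` last_path ?c) = (\<Prod>L\<in>last_path ?c. ?F (l # L))"
    by (subst prod.reindex) auto
  also have "\<dots> = (\<Prod>L\<in>last_path ?c. path_radius ?c ?s L ?v powr (node_p ?c L - node_p ?c (butlast L)))"
    by (rule prod.cong[OF refl child])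
  also have "\<dots> = path_jacobian ?c ?s ?v"
    using Inner.IH[OF lc(3,2)] by (simp add: l_def)
  also have "?F [l] = ?s powr (exponent ?c - p)"
    by (simp add: node_p_def)
  finally show ?case using lc(1) by (simp add: l_def)
qed

lemma prod_node_G: "wf_tree t \<Longrightarrow> (\<Prod>L\<in>last_path t. node_G t L u) = path_jacobian t 1 u"
  unfolding prod_path_radius[symmetric] node_G_def
  by (intro prod.cong refl)
     (simp add: node_g_eq_path_radius[OF subsetD[OF last_path_subset_nodes]])

section \<open>The normalising constant as a product over inner nodes\<close>

lemma finite_inner_nodes: "finite (inner_nodes t)"
proof -
  have "finite (nodes t)" by (induction t) auto
  then show ?thesis by (simp add: inner_nodes_def)
qed

lemma inner_nodes_Inner:
  "inner_nodes (Inner p ts) = insert [] (\<Union>k<length ts. (#) k ` inner_nodes (ts ! k))"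
  by (auto simp: inner_nodes_def)

text \<open>The power of \<open>p\<close> at a node supplies the divisions by \<open>p\<close> in
  its \<open>\<ell> - 1\<close> Beta factors of \<open>radial_const\<close>. The leaves, each a 2 in
  \<open>radial_const\<close>, are missing from the product over inner nodes, which leaves
  \<open>2 ^ nleaves t\<close>.\<close>

lemma prod_inner_nodes:
  assumes "wf_tree t"
  shows "(\<Prod>I\<in>inner_nodes t. node_p t I ^ (node_l t I - 1) *
      (\<Prod>k=1..node_l t I - 1. inverse (Beta ((\<Sum>i<k. real (node_n t (I @ [i]))) / node_p t I)
         (real (node_n t (I @ [k])) / node_p t I)))) = 2 ^ nleaves t / radial_const t"
    (is "prod (?F t) _ = _")
  using assms
proof (induction t)
  case Leaf
  have "inner_nodes Leaf = {}" by (auto simp: inner_nodes_def)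
  then show ?case by simp
next
  case (Inner p ts)
  let ?t = "Inner p ts"
  have child: "?F ?t (k # I) = ?F (ts ! k) I" for k I
    by (simp add: node_p_def node_l_def node_n_def)
  have "prod (?F ?t) (inner_nodes ?t) = ?F ?t [] * (\<Prod>k<length ts. prod (?F ?t) ((#) k ` inner_nodes (ts ! k)))"
    unfolding inner_nodes_Inner
    by (subst prod.insert; (subst prod.UNION_disjoint)?) (auto simp: finite_inner_nodes)
  also have "prod (?F ?t) ((#) k ` A) = prod (?F (ts ! k)) A" for k A
    by (subst prod.reindex) (simp, rule prod.cong[OF refl], simp only: comp_def child)
  then have "(\<Prod>k<length ts. prod (?F ?t) ((#) k ` inner_nodes (ts ! k))) =
      (\<Prod>k<length ts. prod (?F (ts ! k)) (inner_nodes (ts ! k)))"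
    by (rule prod.cong[OF refl])
  also have "(\<Prod>k<length ts. prod (?F (ts ! k)) (inner_nodes (ts ! k))) =
      (\<Prod>k<length ts. 2 ^ nleaves (ts ! k) / radial_const (ts ! k))"
    using Inner by (intro prod.cong) auto
  also have "\<dots> = 2 ^ nleaves ?t / (\<Prod>k<length ts. radial_const (ts ! k))"
    by (simp add: prod_dividef power_sum[symmetric] sum_list_sum_nth atLeast0LessThan)
  also have "?F ?t [] = inverse (\<Prod>k=1..length ts - 1. 
       Beta ((\<Sum>i<k. real (nleaves (ts ! i))) / p) (real (nleaves (ts ! k)) / p) / p)"
  proof -
    have "p ^ n * (\<Prod>k=1..n. inverse (b k)) = inverse (\<Prod>k=1..n. b k / p)" for n and b :: "nat \<Rightarrow> real"
      by (simp add: prod_dividef prod_inversef[unfolded comp_def]) (simp add: divide_inverse)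
    then show ?thesis by (simp only: node_p_def node_l_def node_n_def subtree.simps append_Nil
        exponent.simps nchildren.simps)
  qed
  finally show ?case by (simp add: divide_inverse mult_ac)
qed

lemma sphere_density_eq:
  assumes "wf_tree t"
  shows "sphere_density t u = 2 / radial_const t * path_jacobian t 1 u"
proof -
  have "(2::real) ^ nleaves t = 2 * 2 ^ (nleaves t - 1)"
    using nleaves_pos[OF assms] by (simp flip: power_Suc)
  then show ?thesis
    unfolding sphere_density_def prod_node_G[OF assms] prod_inner_nodes[OF assms] by simp
qed

subsection \<open>Polar integration\<close>

text \<open>On the last axis the norm is the absolute value. Restricting \<open>h (f x)\<close> to
  this axis will recover the measurability of \<open>h\<close> on the nonnegative reals.\<close>

lemma Lp_nested_last_coordinate:
  assumes "wf_tree t" and "\<And>i. i < nleaves t - 1 \<Longrightarrow> x i = 0"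
  shows "Lp_nested t x = \<bar>x (nleaves t - 1)\<bar>"
  using assms
proof (induction t arbitrary: x)
  case (Inner p ts)
  note lc = last_child[OF Inner.prems(1)]
  define l where "l = length ts - 1"
  have N: "nleaves (Inner p ts) - 1 = left_leaves ts l + (nleaves (ts ! l) - 1)"
    using left_leaves_last[OF lc(1)] nleaves_pos[OF lc(2)] by (simp add: l_def)
  have len: "length ts = Suc l" using lc(1) by (simp add: l_def)
  have z: "Lp_nested (ts ! k) (\<lambda>i. x (left_leaves ts k + i)) = 0" if "k < l" for k
  proof -
    \<comment> \<open>Writing the zero vector as \<open>0 * 0\<close> makes homogeneity with factor
      0 applicable.\<close>
    have "Lp_nested (ts ! k) (\<lambda>i. x (left_leaves ts k + i)) = Lp_nested (ts ! k) (\<lambda>i. 0 * 0)"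
    proof (rule Lp_nested_cong)
      fix i assume "i < nleaves (ts ! k)"
      then have "left_leaves ts k + i < left_leaves ts l"
        using left_leaves_add_less_last[OF Inner.prems(1)] that by (simp add: l_def)
      then show "x (left_leaves ts k + i) = 0 * 0" using Inner.prems(2) N by simp
    qed
    also have "\<dots> = 0"
      using Inner.prems(1) that len by (subst Lp_nested_scale) auto
    finally show ?thesis .
  qed
  have "Lp_nested (ts ! l) (\<lambda>i. x (left_leaves ts l + i)) =
        \<bar>x (left_leaves ts l + (nleaves (ts ! l) - 1))\<bar>"
  proof (rule Inner.IH)
    show "ts ! l \<in> set ts" "wf_tree (ts ! l)" using lc(2,3) by (simp_all only: l_def)
    fix i assume "i < nleaves (ts ! l) - 1"
    then show "x (left_leaves ts l + i) = 0"
      by (intro Inner.prems(2)) (use N in linarith)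
  qed
  then show ?case
    using lc(4) z unfolding N by (simp add: len powr_powr)
qed simp

lemma measurable_Lp_nested_upd:
  assumes "nleaves t = Suc m" and "\<And>i. i < m \<Longrightarrow> (\<lambda>w. X w i) \<in> borel_measurable M"
    and "Y \<in> borel_measurable M"
  shows "(\<lambda>w. Lp_nested t ((X w)(m := Y w))) \<in> borel_measurable M"
proof (rule Lp_nested_measurable_aux)
  fix i assume "i < nleaves t"
  then show "(\<lambda>w. ((X w)(m := Y w)) i) \<in> borel_measurable M"
    using assms by (cases "i = m") auto
qed

lemma measurable_unit_jacobian:
  assumes "wf_tree t" and "nleaves t = Suc m"
  shows "(\<lambda>u. ennreal (path_jacobian t 1 u) * indicator {u. Lp_nested t (u(m := 0)) < 1} u)
    \<in> borel_measurable (leb m)"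
proof -
  have [measurable]: "(\<lambda>u. path_jacobian t 1 u) \<in> borel_measurable (leb m)"
    by (rule measurable_path_jacobian[OF assms(1)]) (auto simp: assms(2))
  have [measurable]: "(\<lambda>u. Lp_nested t (u(m := 0))) \<in> borel_measurable (leb m)"
    by (rule measurable_Lp_nested_upd[OF assms(2)]) auto
  have "(\<lambda>u. if Lp_nested t (u(m := 0)) < 1 then ennreal (path_jacobian t 1 u) else 0)
    \<in> borel_measurable (leb m)"
    by measurable
  moreover have "ennreal (path_jacobian t 1 u) * indicator {u. Lp_nested t (u(m := 0)) < 1} u =
      (if Lp_nested t (u(m := 0)) < 1 then ennreal (path_jacobian t 1 u) else 0)" for u
    by simp
  ultimately show ?thesis by simp
qed

text \<open>The right-hand side is a product of a radial and an angular integral: \<open>H\<close>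
  stands for the radial density and \<open>A\<close> tests the projected point. That the law on the
  sphere does not depend on the radial density is visible here.\<close>

lemma nn_integral_polar:
  fixes H :: "real \<Rightarrow> ennreal"
  assumes wf: "wf_tree t" and n: "nleaves t = Suc m"
    and H [measurable]: "H \<in> borel_measurable borel" and A [measurable]: "A \<in> sets (leb m)"
  shows "(\<integral>\<^sup>+x. H (Lp_nested t x) * indicator A (\<lambda>i\<in>{..<m}. x i / Lp_nested t x) \<partial>leb (Suc m)) =
    2 * (\<integral>\<^sup>+r. H r * ennreal (r powr real m) * indicator {0<..} r \<partial>lborel) *
    (\<integral>\<^sup>+u. ennreal (path_jacobian t 1 u) * indicator {u. Lp_nested t (u(m := 0)) < 1} u *
       indicator A u \<partial>leb m)"
proof -
  let ?f = "Lp_nested t" and ?e = "exponent t"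
  \<comment> \<open>Here \<open>r\<close> takes the place of the norm also in the division, so for
    fixed first coordinates the integrand depends on the last one through \<open>r\<close>
    alone.\<close>
  define \<psi> where "\<psi> x r = H r * indicator A (\<lambda>i\<in>{..<m}. x i / r)" for x r
  define Q where "Q x r = (if ?f (x(m := 0)) < r
    then \<psi> x r * ennreal (r powr (?e - 1) * path_jacobian t r x) else 0)" for x r
  define J where "J u = ennreal (path_jacobian t 1 u) * indicator {u. ?f (u(m := 0)) < 1} u" for u
  have f [measurable]: "?f \<in> borel_measurable (leb (Suc m))"
    using Lp_nested_measurable[of t] n by simp
  have scl: "(\<lambda>w. \<lambda>i\<in>{..<m}. X w i / R w) \<in> measurable M (leb m)"
    if "\<And>i. i < m \<Longrightarrow> (\<lambda>w. X w i) \<in> borel_measurable M" "R \<in> borel_measurable M"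
    for X R and M :: "'z measure"
    by (rule measurable_leb) (use that in \<open>auto intro!: borel_measurable_divide\<close>)
  have psi_meas: "(\<lambda>w. \<psi> (X w) (R w)) \<in> borel_measurable M"
    if "\<And>i. i < m \<Longrightarrow> (\<lambda>w. X w i) \<in> borel_measurable M" "R \<in> borel_measurable M"
    for X R and M :: "'z measure"
  proof -
    note [measurable] = scl[OF that] that(2)
    show ?thesis unfolding \<psi>_def by measurable
  qed
  have meas: "(\<lambda>x. \<psi> x (?f x)) \<in> borel_measurable (leb (Suc m))"
    by (rule psi_meas) auto
  have inner: "(\<integral>\<^sup>+y. \<psi> (x(m := y)) (?f (x(m := y))) \<partial>lborel) = 2 * (\<integral>\<^sup>+r. Q x r \<partial>lborel)" for x
  proof -
    have "\<psi> (x(m := y)) r = \<psi> x r" for y r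
      unfolding \<psi>_def by (intro arg_cong[of _ _ "\<lambda>v. H r * indicator A v"] restrict_ext) auto
    then have "(\<integral>\<^sup>+y. \<psi> (x(m := y)) (?f (x(m := y))) \<partial>lborel) =
        (\<integral>\<^sup>+y. \<psi> x (?f (x(m := y))) \<partial>lborel)" by simp
    also have "\<dots> = 2 * (\<integral>\<^sup>+y. \<psi> x (?f (x(m := y))) * indicator {0<..} y \<partial>lborel)"
    proof (rule nn_integral_lborel_even)
      show "(\<lambda>y. \<psi> x (?f (x(m := y)))) \<in> borel_measurable borel"
        by (rule psi_meas) (auto intro!: measurable_Lp_nested_upd[OF n])
      show "\<psi> x (?f (x(m := - y))) = \<psi> x (?f (x(m := y)))" for y
        by (rule arg_cong[of _ _ "\<psi> x"], rule Lp_nested_cong_abs) auto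
    qed
    also have "(\<integral>\<^sup>+y. \<psi> x (?f (x(m := y))) * indicator {0<..} y \<partial>lborel) =
        (\<integral>\<^sup>+r. \<psi> x r * ennreal (r powr (?e - 1) * path_jacobian t r x) *
           indicator {?f (x(m := 0))<..} r \<partial>lborel)"
      by (rule nn_integral_last_coordinate[OF wf, of "\<psi> x" x, unfolded n diff_Suc_1])
        (rule psi_meas, auto)
    also have "\<dots> = (\<integral>\<^sup>+r. Q x r \<partial>lborel)"
      by (intro nn_integral_cong) (simp add: Q_def indicator_def)
    finally show ?thesis .
  qed
  have Q_meas: "(\<lambda>(x, r). Q x r) \<in> borel_measurable (leb m \<Otimes>\<^sub>M lborel)"
  proof -
    have comp: "(\<lambda>w. fst w i) \<in> borel_measurable (leb m \<Otimes>\<^sub>M lborel)" if "i < m" for i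
      by (rule measurable_compose[OF measurable_fst borel_measurable_leb_component[OF that]])
    have [measurable]: "(\<lambda>w. ?f ((fst w)(m := 0))) \<in> borel_measurable (leb m \<Otimes>\<^sub>M lborel)"
      by (rule measurable_Lp_nested_upd[OF n comp]) auto
    have [measurable]: "(\<lambda>w. \<psi> (fst w) (snd w)) \<in> borel_measurable (leb m \<Otimes>\<^sub>M lborel)"
      by (rule psi_meas[OF comp]) auto
    have [measurable]: "(\<lambda>w. path_jacobian t (snd w) (fst w)) \<in> borel_measurable (leb m \<Otimes>\<^sub>M lborel)"
      by (rule measurable_path_jacobian[OF wf]) (use comp n in auto)
    show ?thesis unfolding Q_def case_prod_unfold by measurable
  qed
  have Q_meas1: "(\<lambda>x. Q x r) \<in> borel_measurable (leb m)" for r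
    using measurable_compose[OF measurable_Pair2'[of r lborel "leb m"] Q_meas] by simp
  have J_meas [measurable]: "J \<in> borel_measurable (leb m)"
    unfolding J_def by (rule measurable_unit_jacobian[OF wf n])
  \<comment> \<open>Scaling by \<open>r\<close> gives \<open>r ^ m\<close>; the region and the test
    set become those at radius 1, and the Jacobian does so by its degree 0.\<close>
  have outer: "(\<integral>\<^sup>+x. Q x r \<partial>leb m) =
      H r * ennreal (r powr real m) * indicator {0<..} r * (\<integral>\<^sup>+u. J u * indicator A u \<partial>leb m)" for r
  proof (cases "r > 0")
    case True
    have "(\<integral>\<^sup>+x. Q x r \<partial>leb m) = ennreal (r ^ m) * (\<integral>\<^sup>+u. Q (\<lambda>i\<in>{..<m}. r * u i) r \<partial>leb m)"
      by (rule nn_integral_leb_scale[OF Q_meas1 True])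
    also have "(\<integral>\<^sup>+u. Q (\<lambda>i\<in>{..<m}. r * u i) r \<partial>leb m) =
        (\<integral>\<^sup>+u. H r * (J u * indicator A u) \<partial>leb m)"
    proof (intro nn_integral_cong)
      fix u assume u: "u \<in> space (leb m)"
      have "?f ((\<lambda>i\<in>{..<m}. r * u i)(m := 0)) = ?f (\<lambda>i. r * (u(m := 0)) i)"
        by (rule Lp_nested_cong) (auto simp: n)
      also have "\<dots> = r * ?f (u(m := 0))"
        using True by (intro Lp_nested_scale[OF wf]) simp
      finally have 1: "?f ((\<lambda>i\<in>{..<m}. r * u i)(m := 0)) < r \<longleftrightarrow> ?f (u(m := 0)) < 1"
        using True by simp
      have "path_jacobian t r (\<lambda>i\<in>{..<m}. r * u i) = path_jacobian t r (\<lambda>i. r * u i)"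
        by (rule path_jacobian_cong[OF wf]) (simp add: n)
      then have 2: "r powr (?e - 1) * path_jacobian t r (\<lambda>i\<in>{..<m}. r * u i) = path_jacobian t 1 u"
        using path_jacobian_homogeneous[OF wf True] by simp
      have "(\<lambda>i\<in>{..<m}. (\<lambda>i\<in>{..<m}. r * u i) i / r) = u"
        using u True by (auto simp: space_PiM PiE_def extensional_def fun_eq_iff)
      then have 3: "\<psi> (\<lambda>i\<in>{..<m}. r * u i) r = H r * indicator A u"
        unfolding \<psi>_def by simp
      show "Q (\<lambda>i\<in>{..<m}. r * u i) r = H r * (J u * indicator A u)"
        unfolding Q_def 1 2 3 J_def by (simp add: indicator_def mult_ac)
    qed
    also have "\<dots> = H r * (\<integral>\<^sup>+u. J u * indicator A u \<partial>leb m)"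
      by (rule nn_integral_cmult) measurable
    finally show ?thesis using True by (simp add: powr_realpow mult_ac)
  next
    case False
    then have "Q x r = 0" for x
      using Lp_nested_nonneg[of t "x(m := 0)"] by (simp add: Q_def)
    then show ?thesis using False by simp
  qed
  have H_meas: "(\<lambda>r. H r * ennreal (r powr real m) * indicator {0<..} r) \<in> borel_measurable lborel"
    supply borel_measurable_leb_component [measurable del] by measurable
  have "(\<integral>\<^sup>+x. \<psi> x (?f x) \<partial>leb (Suc m)) = (\<integral>\<^sup>+x. 2 * (\<integral>\<^sup>+r. Q x r \<partial>lborel) \<partial>leb m)"
    unfolding nn_integral_leb_Suc[OF meas] inner ..
  also have "\<dots> = 2 * (\<integral>\<^sup>+x. (\<integral>\<^sup>+r. Q x r \<partial>lborel) \<partial>leb m)"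
    by (rule nn_integral_cmult) (rule lborel.borel_measurable_nn_integral[OF Q_meas])
  also have "(\<integral>\<^sup>+x. (\<integral>\<^sup>+r. Q x r \<partial>lborel) \<partial>leb m) = (\<integral>\<^sup>+r. (\<integral>\<^sup>+x. Q x r \<partial>leb m) \<partial>lborel)"
    by (rule pair_sigma_finite.Fubini'[OF _ Q_meas, symmetric])
       (intro pair_sigma_finite.intro sigma_finite_leb lborel.sigma_finite_measure_axioms)
  also have "\<dots> = (\<integral>\<^sup>+r. H r * ennreal (r powr real m) * indicator {0<..} r \<partial>lborel) *
      (\<integral>\<^sup>+u. J u * indicator A u \<partial>leb m)"
    unfolding outer by (rule nn_integral_multc[OF H_meas])
  finally show ?thesis by (simp only: \<psi>_def J_def mult.assoc)
qed

theorem proposition3: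
  fixes t :: nested_tree and n :: nat and \<nu> :: "(nat \<Rightarrow> real) measure"
  assumes "wf_tree t" and "nleaves t = n" and "n \<ge> 2"
    and "sphere_uniform t \<nu>"
  shows "distributed \<nu> (leb (n - 1)) (\<lambda>x. restrict x {..<n - 1})
           (\<lambda>u. ennreal (sphere_density t u) *
                indicator {u. Lp_nested t (u(n - 1 := 0)) < 1} u)"
proof -
  define m where "m = n - 1"
  have n: "n = Suc m" "nleaves t = Suc m" using assms(2,3) by (auto simp: m_def)
  note wf = assms(1)
  let ?f = "Lp_nested t" and ?K = "radial_const t"
  have f [measurable]: "?f \<in> borel_measurable (leb (Suc m))"
    using Lp_nested_measurable[of t] n by simp
  obtain h :: "real \<Rightarrow> ennreal" where h [measurable]: "(\<lambda>x. h (?f x)) \<in> borel_measurable (leb (Suc m))"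
    and prob: "prob_space (density (leb (Suc m)) (\<lambda>x. h (?f x)))"
    and \<nu>: "\<nu> = distr (density (leb (Suc m)) (\<lambda>x. h (?f x))) (leb (Suc m))
               (\<lambda>x. \<lambda>i\<in>{..<Suc m}. x i / ?f x)"
    using assms(4) n unfolding sphere_uniform_def Let_def by auto
  define \<mu> where "\<mu> = density (leb (Suc m)) (\<lambda>x. h (?f x))"
  \<comment> \<open>Only \<open>h\<close> composed with the norm is known to be measurable, and
    \<open>h\<close> is arbitrary on negative numbers. The absolute value makes it a Borel function
    that agrees with \<open>h\<close> on all values of the norm.\<close>
  define H where "H r = h \<bar>r\<bar>" for r
  define J where "J u = ennreal (path_jacobian t 1 u) * indicator {u. ?f (u(m := 0)) < 1} u" for u
  define D where "D u = ennreal (sphere_density t u) * indicator {u. ?f (u(m := 0)) < 1} u" for u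
  define c where "c = (\<integral>\<^sup>+r. H r * ennreal (r powr real m) * indicator {0<..} r \<partial>lborel)"
  have Hf: "H (?f x) = h (?f x)" for x by (simp add: H_def Lp_nested_nonneg)
  have H: "H \<in> borel_measurable borel"
  proof -
    have "(\<lambda>r. \<lambda>i\<in>{..<Suc m}. if i = m then r else 0) \<in> measurable borel (leb (Suc m))"
      by (rule measurable_leb) simp
    from measurable_compose[OF this h]
    have "(\<lambda>r. h (?f (\<lambda>i\<in>{..<Suc m}. if i = m then r else 0))) \<in> borel_measurable borel" .
    moreover have "?f (\<lambda>i\<in>{..<Suc m}. if i = m then r else 0) = \<bar>r\<bar>" for r
      using Lp_nested_last_coordinate[OF wf, of "\<lambda>i\<in>{..<Suc m}. if i = m then r else 0"] n by simp
    ultimately show ?thesis by (simp add: H_def[abs_def])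
  qed
  have K: "?K > 0" by (rule radial_const_pos[OF wf])
  have "1 = (\<integral>\<^sup>+x. h (?f x) \<partial>leb (Suc m))"
    using prob_space.emeasure_space_1[OF prob] by (simp add: emeasure_density cong: nn_integral_cong)
  also have "\<dots> = ennreal ?K * c"
    using nn_integral_Lp_nested[OF wf H] by (simp add: Hf n c_def)
  \<comment> \<open>A priori \<open>c\<close> could be infinite, so the equation
    \<open>1 = K c\<close> is multiplied by \<open>1 / K\<close> instead of being solved by real
    division.\<close>
  finally have "ennreal (1 / ?K) * (ennreal ?K * c) = ennreal (1 / ?K)" by simp
  then have c: "c = ennreal (1 / ?K)"
    using K by (simp add: mult.assoc[symmetric] ennreal_mult'[symmetric])
  have J_meas: "J \<in> borel_measurable (leb m)"
    unfolding J_def by (rule measurable_unit_jacobian[OF wf n(2)])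
  have D: "D u = 2 * c * J u" for u
  proof -
    have "ennreal (sphere_density t u) = 2 * ennreal (1 / ?K) * ennreal (path_jacobian t 1 u)"
      using K by (simp add: sphere_density_eq[OF wf] ennreal_mult' divide_inverse mult.assoc)
    then show ?thesis by (simp only: D_def J_def c mult.assoc)
  qed
  have D_meas: "D \<in> borel_measurable (leb m)"
    unfolding D using J_meas by measurable
  \<comment> \<open>Needed for \<open>k = Suc m\<close>, the normalised vector, and for
    \<open>k = m\<close>, its projection. Where the norm vanishes the quotients are 0.\<close>
  have T: "(\<lambda>x. \<lambda>i\<in>{..<k}. x i / ?f x) \<in> measurable \<mu> (leb k)" if "k \<le> Suc m" for k
    unfolding \<mu>_def using that by (intro measurable_leb) (auto intro!: borel_measurable_divide)
  have R: "(\<lambda>x. restrict x {..<m}) \<in> measurable (leb (Suc m)) (leb m)"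
    by (rule measurable_leb) simp
  have "distr \<nu> (leb m) (\<lambda>x. restrict x {..<m}) = distr \<mu> (leb m) (\<lambda>x. \<lambda>i\<in>{..<m}. x i / ?f x)"
  proof -
    have "(\<lambda>x. restrict x {..<m}) \<circ> (\<lambda>x. \<lambda>i\<in>{..<Suc m}. x i / ?f x) = (\<lambda>x. \<lambda>i\<in>{..<m}. x i / ?f x)"
      by (auto simp: fun_eq_iff)
    then show ?thesis
      unfolding \<nu> \<mu>_def[symmetric] using distr_distr[OF R T[of "Suc m"]] by simp
  qed
  also have "\<dots> = density (leb m) D"
  proof (rule measure_eqI)
    fix A assume "A \<in> sets (distr \<mu> (leb m) (\<lambda>x. \<lambda>i\<in>{..<m}. x i / ?f x))"
    then have A: "A \<in> sets (leb m)" by simp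
    let ?T = "\<lambda>x. \<lambda>i\<in>{..<m}. x i / ?f x"
    have TA: "?T -` A \<inter> space \<mu> \<in> sets (leb (Suc m))"
      using measurable_sets[OF T[of m] A] by (simp add: \<mu>_def)
    have "emeasure (distr \<mu> (leb m) ?T) A = emeasure \<mu> (?T -` A \<inter> space \<mu>)"
      by (rule emeasure_distr[OF T A]) simp
    also have "\<dots> = (\<integral>\<^sup>+x. h (?f x) * indicator (?T -` A \<inter> space \<mu>) x \<partial>leb (Suc m))"
      using TA unfolding \<mu>_def by (intro emeasure_density h)
    also have "\<dots> = (\<integral>\<^sup>+x. H (?f x) * indicator A (?T x) \<partial>leb (Suc m))"
      by (intro nn_integral_cong) (auto simp: Hf \<mu>_def indicator_def)
    also have "\<dots> = 2 * c * (\<integral>\<^sup>+u. J u * indicator A u \<partial>leb m)"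
      unfolding c_def J_def by (rule nn_integral_polar[OF wf n(2) H A])
    also have "\<dots> = (\<integral>\<^sup>+u. 2 * c * (J u * indicator A u) \<partial>leb m)"
      by (intro nn_integral_cmult[symmetric] borel_measurable_times_ennreal J_meas
          borel_measurable_indicator A)
    also have "\<dots> = emeasure (density (leb m) D) A"
      by (simp add: emeasure_density[OF D_meas A] D mult.assoc)
    finally show "emeasure (distr \<mu> (leb m) ?T) A = emeasure (density (leb m) D) A" .
  qed simp
  finally show ?thesis
    using D_meas R unfolding distributed_def m_def[symmetric] D_def \<nu> by simp
qed

end
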